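(* For every $c\in\mathbb{R}$, every $(\Psi,\eta)=(\Psi_{\mathrm{k}},\eta_{\mathrm{k}})_{\mathrm{k}\in\mathcal{K}}\in\big((H^1_{\#}(\Omega,\mathbb{C}))^{N}\big)^{|\mathcal{K}|}\times\big(\mathcal{S}^{N\times N}_{\mathbb{C}}\big)^{|\mathcal{K}|}$ and every $P=(P_{\mathrm{k}})_{\mathrm{k}\in\mathcal{K}}\in\big(\mathcal{O}^{N\times N}_{\mathbb{C}}\big)^{|\mathcal{K}|}$, $$\mathcal{F}\big(\Psi P,\;P^*(\eta+cI_N)P\big)=\mathcal{F}(\Psi,\eta),$$ where $\Psi P=(\Psi_{\mathrm{k}}P_{\mathrm{k}})_{\mathrm{k}\in\mathcal{K}}$ and $P^*(\eta+cI_N)P=(P_{\mathrm{k}}^*(\eta_{\mathrm{k}}+cI_N)P_{\mathrm{k}})_{\mathrm{k}\in\mathcal{K}}$.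
   Context: Notation. $\Omega\subset\mathbb{R}^3$ is the unit cell of a Bravais lattice $\mathcal{R}$; $L^2_{\#}(\Omega,\mathbb{C})$ and $H^1_{\#}(\Omega,\mathbb{C})$ are the spaces of complex-valued $\mathcal{R}$-periodic functions that are locally $L^2$, resp. $H^1$; $(\psi,\phi)=\int_\Omega\bar\psi\phi$. For tuples $\Psi=(\psi_1,\dots,\psi_p)$, $\Phi=(\phi_1,\dots,\phi_q)$ of functions, $\langle\Psi^*\Phi\rangle=((\psi_i,\phi_j))_{i,j}$, $\Psi^*\Phi=(\bar\psi_i\phi_j)_{i,j}$ (matrix of functions), and for a matrix $A$, $(\Psi A)_j=\sum_i A_{ij}\psi_i$. $\mathcal{S}^{N\times N}_{\mathbb{C}}$ is the set of Hermitian and $\mathcal{O}^{N\times N}_{\mathbb{C}}$ the set of unitary $N\times N$ complex matrices. Real functions are applied to Hermitian matrices by functional calculus. Data. $\mathcal{K}\subset\mathbb{R}^3$ is a finite set of k-points with weights $w_{\mathrm{k}}>0$, $\sum_{\mathrm{k}}w_{\mathrm{k}}=2$; $\sigma>0$; $N_e$ is the number of electrons, with $0<N_e<2N$; $M=(\varphi_1,\dots,\varphi_m)\in(L^2_{\#}(\Omega,\mathbb{C}))^m$; $\mathcal{Q}$ is an $m\times m$ Hermitian-matrix-valued function with entries in $L^2_{\#}(\Omega,\mathbb{C})$; $D$ is a Hermitian $m\times m$ matrix; $V_{\mathrm{nl}}\Psi=MD\langle M^*\Psi\rangle$; $V_{\mathrm{loc}}\in L^2_{\#}$; $\mathcal{E}_{\mathrm{xc}}$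 is a functional of the density. Smearing functions $f,S:\mathbb{R}\to\mathbb{R}$ satisfy: (A.I) $f,S$ are analytic and $S'(x)=xf'(x)$; (A.II) $f(x)\to1$ as $x\to-\infty$ and $f(x)\to0$ as $x\to+\infty$; (A.III) $\lim_{x\to\pm\infty}S(x)$ exist; (A.IV) $f$ is strictly decreasing. For $\eta\in(\mathcal{S}^{N\times N}_{\mathbb{C}})^{|\mathcal{K}|}$, $\mu=\mu(\eta)\in\mathbb{R}$ is the unique number such that $\sum_{\mathrm{k}}w_{\mathrm{k}}\operatorname{tr}F_{\eta_{\mathrm{k}}}=N_e$, where $F_{\eta_{\mathrm{k}}}=f\big(\tfrac1\sigma(\eta_{\mathrm{k}}-\mu I_N)\big)$. Energy. With density $\rho_{\Psi,\eta}=\sum_{\mathrm{k}}w_{\mathrm{k}}\operatorname{tr}\big((\Psi_{\mathrm{k}}^*\Psi_{\mathrm{k}}+\langle\Psi_{\mathrm{k}}^*M\rangle\mathcal{Q}\langle M^*\Psi_{\mathrm{k}}\rangle)F_{\eta_{\mathrm{k}}}\big)$, $$\mathcal{F}(\Psi,\eta)=\sum_{\mathrm{k}}w_{\mathrm{k}}\operatorname{tr}\Big(\big\langle\Psi_{\mathrm{k}}^*\big(-\tfrac12(\mathrm{i}\mathrm{k}+\nabla)^2+V_{\mathrm{nl}}\big)\Psi_{\mathrm{k}}\big\rangle F_{\eta_{\mathrm{k}}}\Big)+\int_\Omega V_{\mathrm{loc}}\,\rho_{\Psi,\eta}+\frac12\int_\Omega\int_\Omega\frac{\rho_{\Psi,\eta}(r)\rho_{\Psi,\eta}(r')}{|r-r'|}\,dr\,dr'+\mathcal{E}_{\mathrm{xc}}(\rho_{\Psi,\eta})-\sigma\sum_{\mathrm{k}}w_{\mathrm{k}}\operatorname{tr}S\big(\tfrac1\sigma(\eta_{\mathrm{k}}-\mu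 I_N)\big),$$ where $(\psi,-\tfrac12(\mathrm{i}\mathrm{k}+\nabla)^2\phi)$ means $\tfrac12\int_\Omega\overline{(\mathrm{i}\mathrm{k}+\nabla)\psi}\cdot(\mathrm{i}\mathrm{k}+\nabla)\phi$. *)

theory Defs
  imports "HOL-Analysis.Analysis"
begin

section \<open>Complex matrices and functional calculus\<close>

definition cadjoint :: "complex^'n^'m \<Rightarrow> complex^'m^'n" where
  "cadjoint A = (\<chi> i j. cnj (A $ j $ i))"

definition hermitian :: "complex^'n^'n \<Rightarrow> bool" where
  "hermitian A \<longleftrightarrow> cadjoint A = A"

definition unitary :: "complex^'n^'n \<Rightarrow> bool" where
  "unitary U \<longleftrightarrow> cadjoint U ** U = mat 1 \<and> U ** cadjoint U = mat 1"

definition diag_real :: "('n \<Rightarrow> real) \<Rightarrow> complex^'n^'n" where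
  "diag_real d = (\<chi> i j. if i = j then complex_of_real (d i) else 0)"

text \<open>
  If \<open>A = U diag(d) U*\<close> with \<open>U\<close> unitary, then \<open>g(A) = U diag(g d) U*\<close>. The value does not
  depend on the chosen diagonalization (lemma \<open>matrix_fun_eq\<close> below), and every Hermitian
  matrix has one.
\<close>
definition matrix_fun :: "(real \<Rightarrow> real) \<Rightarrow> complex^'n^'n \<Rightarrow> complex^'n^'n" where
  "matrix_fun g A = (THE B. \<exists>U d. unitary U \<and> A = U ** diag_real d ** cadjoint U
                               \<and> B = U ** diag_real (\<lambda>i. g (d i)) ** cadjoint U)"

lemma diag_real_mult_left: "(diag_real d ** W) $ i $ j = complex_of_real (d i) * W $ i $ j"
  by (simp add: matrix_matrix_mult_def diag_real_def if_distrib [of "\<lambda>x. x * _"] cong: if_cong)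

lemma diag_real_mult_right: "(W ** diag_real d) $ i $ j = W $ i $ j * complex_of_real (d j)"
  by (simp add: matrix_matrix_mult_def diag_real_def if_distrib [of "\<lambda>x. _ * x"] cong: if_cong)

lemma matrix_fun_eq:
  fixes U :: "complex^'n^'n"
  assumes U: "unitary U" and A: "A = U ** diag_real d ** cadjoint U"
  shows "matrix_fun g A = U ** diag_real (\<lambda>i. g (d i)) ** cadjoint U"
  unfolding matrix_fun_def
proof (rule the_equality)
  show "\<exists>U' d'. unitary U' \<and> A = U' ** diag_real d' ** cadjoint U'
          \<and> U ** diag_real (\<lambda>i. g (d i)) ** cadjoint U
            = U' ** diag_real (\<lambda>i. g (d' i)) ** cadjoint U'"
    using assms by blast
next
  fix B
  assume "\<exists>V e. unitary V \<and> A = V ** diag_real e ** cadjoint V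
            \<and> B = V ** diag_real (\<lambda>i. g (e i)) ** cadjoint V"
  then obtain V e where V: "unitary V" and A': "A = V ** diag_real e ** cadjoint V"
    and B: "B = V ** diag_real (\<lambda>i. g (e i)) ** cadjoint V" by blast
  have U1: "cadjoint U ** U = mat 1" "U ** cadjoint U = mat 1"
    and V1: "cadjoint V ** V = mat 1" "V ** cadjoint V = mat 1"
    using U V by (auto simp: unitary_def)
  define W where "W = cadjoint V ** U"
  have "cadjoint V ** (U ** diag_real d ** cadjoint U) ** U
      = cadjoint V ** (V ** diag_real e ** cadjoint V) ** U"
    using A A' by simp
  then have "W ** diag_real d ** (cadjoint U ** U) = (cadjoint V ** V) ** diag_real e ** W"
    unfolding W_def by (simp only: matrix_mul_assoc)
  then have WD: "W ** diag_real d = diag_real e ** W"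
    by (simp add: U1 V1)
  have "W $ i $ j * complex_of_real (g (d j)) = complex_of_real (g (e i)) * W $ i $ j" for i j
  proof -
    have "W $ i $ j * complex_of_real (d j) = complex_of_real (e i) * W $ i $ j"
      using arg_cong[OF WD, of "\<lambda>M. M $ i $ j"]
      by (simp add: diag_real_mult_left diag_real_mult_right)
    then show ?thesis by (cases "W $ i $ j = 0") auto
  qed
  then have WG: "W ** diag_real (\<lambda>i. g (d i)) = diag_real (\<lambda>i. g (e i)) ** W"
    by (simp add: vec_eq_iff diag_real_mult_left diag_real_mult_right)
  have "V ** (W ** diag_real (\<lambda>i. g (d i))) ** cadjoint U
      = V ** (diag_real (\<lambda>i. g (e i)) ** W) ** cadjoint U"
    using WG by simp
  then have "(V ** cadjoint V) ** U ** diag_real (\<lambda>i. g (d i)) ** cadjoint U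
      = V ** diag_real (\<lambda>i. g (e i)) ** cadjoint V ** (U ** cadjoint U)"
    unfolding W_def by (simp only: matrix_mul_assoc)
  then show "B = U ** diag_real (\<lambda>i. g (d i)) ** cadjoint U"
    by (simp add: U1 V1 B)
qed


section \<open>Lattice, unit cell and periodic function spaces\<close>

definition bravais_lattice :: "(real^3) set \<Rightarrow> bool" where
  "bravais_lattice R \<longleftrightarrow> (\<exists>a :: 3 \<Rightarrow> real^3. inj a \<and> independent (range a) \<and>
     R = {x. \<exists>n :: 3 \<Rightarrow> int. x = (\<Sum>i\<in>UNIV. of_int (n i) *\<^sub>R a i)})"

text \<open>
  A unit cell is only required to tile space up to null sets, so that half-open and closed
  parallelepipeds and the Wigner-Seitz cell are all included.
\<close>
definition unit_cell :: "(real^3) set \<Rightarrow> (real^3) set \<Rightarrow> bool" where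
  "unit_cell R \<Omega> \<longleftrightarrow> bounded \<Omega> \<and> \<Omega> \<in> sets lebesgue \<and>
     negligible (- (\<Union>t\<in>R. (\<lambda>x. x + t) ` \<Omega>)) \<and>
     (\<forall>t\<in>R. t \<noteq> 0 \<longrightarrow> negligible (\<Omega> \<inter> (\<lambda>x. x + t) ` \<Omega>))"

definition periodic :: "(real^3) set \<Rightarrow> (real^3 \<Rightarrow> complex) \<Rightarrow> bool" where
  "periodic R u \<longleftrightarrow> (\<forall>t\<in>R. AE x in lebesgue. u (x + t) = u x)"

definition L2_loc :: "(real^3 \<Rightarrow> 'b::real_normed_vector) \<Rightarrow> bool" where
  "L2_loc u \<longleftrightarrow> u \<in> borel_measurable lebesgue \<and>
     (\<forall>C. compact C \<longrightarrow> set_integrable lebesgue C (\<lambda>x. (norm (u x))\<^sup>2))"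

definition L2_per :: "(real^3) set \<Rightarrow> (real^3 \<Rightarrow> complex) set" where
  "L2_per R = {u. periodic R u \<and> L2_loc u}"

definition partial_deriv :: "3 \<Rightarrow> (real^3 \<Rightarrow> real) \<Rightarrow> real^3 \<Rightarrow> real" where
  "partial_deriv j \<phi> x = frechet_derivative \<phi> (at x) (axis j 1)"

primrec C_k :: "nat \<Rightarrow> (real^3 \<Rightarrow> real) \<Rightarrow> bool" where
  "C_k 0 \<phi> \<longleftrightarrow> continuous_on UNIV \<phi>"
| "C_k (Suc n) \<phi> \<longleftrightarrow> \<phi> differentiable_on UNIV \<and> (\<forall>j. C_k n (partial_deriv j \<phi>))"

definition test_function :: "(real^3 \<Rightarrow> real) \<Rightarrow> bool" where
  "test_function \<phi> \<longleftrightarrow> (\<forall>n. C_k n \<phi>) \<and> compact (closure {x. \<phi> x \<noteq> 0})"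

definition is_weak_gradient :: "(real^3 \<Rightarrow> complex) \<Rightarrow> (real^3 \<Rightarrow> complex^3) \<Rightarrow> bool" where
  "is_weak_gradient u G \<longleftrightarrow> L2_loc G \<and>
     (\<forall>\<phi> j. test_function \<phi> \<longrightarrow>
        (LINT x|lebesgue. complex_of_real (partial_deriv j \<phi> x) * u x)
          = - (LINT x|lebesgue. complex_of_real (\<phi> x) * G x $ j))"

definition H1_per :: "(real^3) set \<Rightarrow> (real^3 \<Rightarrow> complex) set" where
  "H1_per R = {u \<in> L2_per R. \<exists>G. is_weak_gradient u G}"

text \<open>The weak gradient is determined almost everywhere only; it is used under integrals.\<close>
definition weak_gradient :: "(real^3 \<Rightarrow> complex) \<Rightarrow> real^3 \<Rightarrow> complex^3" where
  "weak_gradient u = (SOME G. is_weak_gradient u G)"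


section \<open>Tuples of functions\<close>

definition cell_inner :: "(real^3) set \<Rightarrow> (real^3 \<Rightarrow> complex) \<Rightarrow> (real^3 \<Rightarrow> complex) \<Rightarrow> complex" where
  "cell_inner \<Omega> \<psi> \<phi> = (LINT r:\<Omega>|lebesgue. cnj (\<psi> r) * \<phi> r)"

definition gram ::
  "(real^3) set \<Rightarrow> (real^3 \<Rightarrow> complex)^'p \<Rightarrow> (real^3 \<Rightarrow> complex)^'q \<Rightarrow> complex^'q^'p" where
  "gram \<Omega> \<Psi> \<Phi> = (\<chi> i j. cell_inner \<Omega> (\<Psi> $ i) (\<Phi> $ j))"

definition star_prod ::
  "(real^3 \<Rightarrow> complex)^'p \<Rightarrow> (real^3 \<Rightarrow> complex)^'q \<Rightarrow> real^3 \<Rightarrow> complex^'q^'p" where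
  "star_prod \<Psi> \<Phi> r = (\<chi> i j. cnj ((\<Psi> $ i) r) * (\<Phi> $ j) r)"

definition tuple_mult ::
  "(real^3 \<Rightarrow> complex)^'p \<Rightarrow> complex^'q^'p \<Rightarrow> (real^3 \<Rightarrow> complex)^'q" where
  "tuple_mult \<Psi> A = (\<chi> j. (\<lambda>r. \<Sum>i\<in>UNIV. A $ i $ j * (\<Psi> $ i) r))"

definition k_gradient :: "real^3 \<Rightarrow> (real^3 \<Rightarrow> complex) \<Rightarrow> real^3 \<Rightarrow> complex^3" where
  "k_gradient k \<psi> r = (\<chi> j. \<i> * complex_of_real (k $ j) * \<psi> r + weak_gradient \<psi> r $ j)"

text \<open>The matrix \<open>\<langle>\<Psi>* (-1/2 (ik + \<nabla>)\<^sup>2) \<Psi>\<rangle>\<close>, understood through its quadratic form.\<close>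
definition kinetic_matrix ::
  "(real^3) set \<Rightarrow> real^3 \<Rightarrow> (real^3 \<Rightarrow> complex)^'n \<Rightarrow> complex^'n^'n" where
  "kinetic_matrix \<Omega> k \<Psi> = (\<chi> i j. 1/2 *
     (LINT r:\<Omega>|lebesgue. \<Sum>l\<in>UNIV. cnj (k_gradient k (\<Psi> $ i) r $ l) * k_gradient k (\<Psi> $ j) r $ l))"

definition V_nl ::
  "(real^3) set \<Rightarrow> (real^3 \<Rightarrow> complex)^'m \<Rightarrow> complex^'m^'m
     \<Rightarrow> (real^3 \<Rightarrow> complex)^'n \<Rightarrow> (real^3 \<Rightarrow> complex)^'n" where
  "V_nl \<Omega> M D \<Psi> = tuple_mult M (D ** gram \<Omega> M \<Psi>)"


section \<open>Smearing\<close>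

definition real_analytic :: "(real \<Rightarrow> real) \<Rightarrow> bool" where
  "real_analytic g \<longleftrightarrow> (\<forall>x. \<exists>a. \<exists>e>0. \<forall>y. \<bar>y - x\<bar> < e \<longrightarrow> (\<lambda>n. a n * (y - x) ^ n) sums g y)"

definition smearing :: "(real \<Rightarrow> real) \<Rightarrow> (real \<Rightarrow> real) \<Rightarrow> bool" where
  "smearing f S \<longleftrightarrow>
     real_analytic f \<and> real_analytic S \<and> (\<forall>x. deriv S x = x * deriv f x) \<and>
     (f \<longlongrightarrow> 1) at_bot \<and> (f \<longlongrightarrow> 0) at_top \<and>
     (\<exists>l. (S \<longlongrightarrow> l) at_bot) \<and> (\<exists>l. (S \<longlongrightarrow> l) at_top) \<and>
     strict_antimono_on UNIV f"

text \<open>\<open>g((A - \<mu> I)/\<sigma>)\<close>\<close>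
definition smeared :: "(real \<Rightarrow> real) \<Rightarrow> real \<Rightarrow> real \<Rightarrow> complex^'n^'n \<Rightarrow> complex^'n^'n" where
  "smeared g \<sigma> \<mu> A = matrix_fun g ((1 / \<sigma>) *\<^sub>R (A - \<mu> *\<^sub>R mat 1))"

definition fermi_level ::
  "(real^3) set \<Rightarrow> (real^3 \<Rightarrow> real) \<Rightarrow> real \<Rightarrow> nat \<Rightarrow> (real \<Rightarrow> real)
     \<Rightarrow> (real^3 \<Rightarrow> complex^'n^'n) \<Rightarrow> real" where
  "fermi_level K w \<sigma> Ne f \<eta> =
     (THE \<mu>. (\<Sum>k\<in>K. complex_of_real (w k) * trace (smeared f \<sigma> \<mu> (\<eta> k))) = of_nat Ne)"


section \<open>Density and energy\<close>

text \<open>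
  Density and energy are kept complex-valued, so that the defining formulas are used as they
  stand. They are real if the data are; a functional of real densities is a special case of
  \<open>Exc\<close>. The families \<open>\<Psi>\<close> and \<open>\<eta>\<close> enter only through their values on \<open>K\<close>.
\<close>

definition density ::
  "(real^3) set \<Rightarrow> (real^3) set \<Rightarrow> (real^3 \<Rightarrow> real) \<Rightarrow> real \<Rightarrow> nat \<Rightarrow> (real \<Rightarrow> real)
     \<Rightarrow> (real^3 \<Rightarrow> complex)^'m \<Rightarrow> (real^3 \<Rightarrow> complex^'m^'m)
     \<Rightarrow> (real^3 \<Rightarrow> (real^3 \<Rightarrow> complex)^'n) \<Rightarrow> (real^3 \<Rightarrow> complex^'n^'n) \<Rightarrow> real^3 \<Rightarrow> complex" where
  "density \<Omega> K w \<sigma> Ne f M Q \<Psi> \<eta> r =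
     (\<Sum>k\<in>K. complex_of_real (w k) *
        trace ((star_prod (\<Psi> k) (\<Psi> k) r + gram \<Omega> (\<Psi> k) M ** Q r ** gram \<Omega> M (\<Psi> k))
               ** smeared f \<sigma> (fermi_level K w \<sigma> Ne f \<eta>) (\<eta> k)))"

definition energy ::
  "(real^3) set \<Rightarrow> (real^3) set \<Rightarrow> (real^3 \<Rightarrow> real) \<Rightarrow> real \<Rightarrow> nat \<Rightarrow> (real \<Rightarrow> real) \<Rightarrow> (real \<Rightarrow> real)
     \<Rightarrow> (real^3 \<Rightarrow> complex)^'m \<Rightarrow> (real^3 \<Rightarrow> complex^'m^'m) \<Rightarrow> complex^'m^'m
     \<Rightarrow> (real^3 \<Rightarrow> complex) \<Rightarrow> ((real^3 \<Rightarrow> complex) \<Rightarrow> complex)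
     \<Rightarrow> (real^3 \<Rightarrow> (real^3 \<Rightarrow> complex)^'n) \<Rightarrow> (real^3 \<Rightarrow> complex^'n^'n) \<Rightarrow> complex" where
  "energy \<Omega> K w \<sigma> Ne f S M Q D Vloc Exc \<Psi> \<eta> =
     (let \<mu> = fermi_level K w \<sigma> Ne f \<eta>;
          \<rho> = density \<Omega> K w \<sigma> Ne f M Q \<Psi> \<eta>
      in (\<Sum>k\<in>K. complex_of_real (w k) *
             trace ((kinetic_matrix \<Omega> k (\<Psi> k) + gram \<Omega> (\<Psi> k) (V_nl \<Omega> M D (\<Psi> k)))
                    ** smeared f \<sigma> \<mu> (\<eta> k)))
         + (LINT r:\<Omega>|lebesgue. Vloc r * \<rho> r)
         + 1/2 * (LINT r:\<Omega>|lebesgue. (LINT r':\<Omega>|lebesgue.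
                     \<rho> r * \<rho> r' / complex_of_real (norm (r - r'))))
         + Exc \<rho>
         - complex_of_real \<sigma> *
             (\<Sum>k\<in>K. complex_of_real (w k) * trace (smeared S \<sigma> \<mu> (\<eta> k))))"

end

theory Submission
  imports Defs "HOL-Computational_Algebra.Polynomial"
begin

text \<open>
  The rotation by \<open>P\<close> conjugates every matrix occurring under a trace by \<open>P\<close>, and the shift by
  \<open>c\<close> moves the Fermi level by \<open>c\<close>, because the equation for \<open>\<mu>\<close> has exactly one solution; so all
  terms of the energy are unchanged. Two facts carry the weight. Functional calculus commutes
  with conjugation only for diagonalizable arguments (\<open>matrix_fun\<close> is otherwise an arbitrary value),
  so Hermitian matrices have to be diagonalized; this is done by maximizing the sum of the
  squared diagonal entries over the compact unitary group, since a Jacobi rotation increases it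
  unless the matrix is diagonal. And \<open>weak_gradient\<close> is an arbitrary choice, so its linearity
  holds only almost everywhere and rests on the fundamental lemma of the calculus of variations.
\<close>

section \<open>Unitary diagonalization\<close>

text \<open>Several notions carry arbitrary or default values: \<open>THE\<close> in
  \<open>matrix_fun\<close> and \<open>fermi_level\<close>, \<open>SOME\<close> in
  \<open>weak_gradient\<close>, and the value 0 for the integral of a non-integrable function.
  Linearity of an integral is therefore available only after integrability is known, which comes
  from local square integrability and the boundedness of \<Omega>. Two kinds of equality are kept
  apart. The rotated density agrees with the original one at every point, since
  \<open>star_prod\<close> is algebraic in the function values; hence an arbitrary functional
  \<open>Exc\<close> takes the same value on both. Weak gradients occur in the kinetic matrix, under
  an integral, where equality almost everywhere is enough. The fundamental lemma needs concrete test
  functions: products of functions exp(- \<epsilon> / t) are taken because they converge to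
  indicators of boxes as \<epsilon> tends to 0, and boxes generate the Borel sets. For the Fermi
  level, strict monotonicity of \<open>f\<close> gives uniqueness, while its continuity and its
  limits give existence.\<close>

lemma cadjoint_mult: "cadjoint (A ** B) = cadjoint B ** cadjoint A"
  by (simp add: cadjoint_def matrix_matrix_mult_def vec_eq_iff mult.commute)

lemma cadjoint_cadjoint [simp]: "cadjoint (cadjoint A) = A"
  by (simp add: cadjoint_def vec_eq_iff)

lemma cadjoint_scaleR: "cadjoint (a *\<^sub>R A) = a *\<^sub>R cadjoint A"
  by (simp add: cadjoint_def vec_eq_iff)

lemma cadjoint_diff: "cadjoint (A - B) = cadjoint A - cadjoint B"
  by (simp add: cadjoint_def vec_eq_iff)

lemma cadjoint_mat_1: "cadjoint (mat 1) = mat 1"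
  by (auto simp: cadjoint_def vec_eq_iff mat_def)

lemma unitary_mult:
  assumes "unitary U" "unitary V"
  shows "unitary (U ** V)"
proof -
  have "cadjoint V ** cadjoint U ** (U ** V) = cadjoint V ** (cadjoint U ** U) ** V"
    "(U ** V) ** (cadjoint V ** cadjoint U) = U ** (V ** cadjoint V) ** cadjoint U"
    by (simp_all only: matrix_mul_assoc)
  then show ?thesis
    using assms by (simp add: unitary_def cadjoint_mult)
qed

lemma unitary_cadjoint: "unitary U \<Longrightarrow> unitary (cadjoint U)"
  by (simp add: unitary_def)

lemma unitaryI: "cadjoint U ** U = mat 1 \<Longrightarrow> unitary U"
  using matrix_left_right_inverse by (auto simp: unitary_def)

lemma conj_component:
  "(cadjoint G ** B ** G) $ i $ j = (\<Sum>k\<in>UNIV. \<Sum>l\<in>UNIV. cnj (G $ k $ i) * B $ k $ l * G $ l $ j)"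
  unfolding matrix_matrix_mult_def cadjoint_def
  by (simp add: sum_distrib_right) (rule sum.swap)

text \<open>The columns of a unitary matrix are unit vectors, which bounds every entry by 1. For
  square matrices a left inverse is two-sided, so the single closed condition
  \<open>cadjoint U ** U = mat 1\<close> describes the set.\<close>

lemma compact_unitary: "compact {U :: complex^'n^'n. unitary U}"
proof (rule compact_eq_bounded_closed[THEN iffD2], intro conjI)
  have "norm U \<le> real CARD('n) * real CARD('n)" if "unitary U" for U :: "complex^'n^'n"
  proof -
    have entry: "norm (U $ k $ i) \<le> 1" for k i
    proof -
      have "(cadjoint U ** U) $ i $ i = 1"
        using that by (simp add: unitary_def mat_def)
      then have "(\<Sum>k\<in>UNIV. complex_of_real ((norm (U $ k $ i))\<^sup>2)) = 1"
        by (simp add: matrix_matrix_mult_def cadjoint_def complex_norm_square mult.commute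
            del: of_real_power)
      then have s: "(\<Sum>k\<in>UNIV. (norm (U $ k $ i))\<^sup>2) = 1"
        by (metis of_real_eq_1_iff of_real_sum)
      have "(norm (U $ k $ i))\<^sup>2 \<le> (\<Sum>k\<in>UNIV. (norm (U $ k $ i))\<^sup>2)"
        by (rule member_le_sum) auto
      then show ?thesis
        using s by (simp add: power_le_one_iff)
    qed
    have "norm U \<le> (\<Sum>k\<in>UNIV. norm (U $ k))"
      by (simp add: norm_vec_def L2_set_le_sum)
    also have "\<dots> \<le> (\<Sum>k\<in>(UNIV::'n set). real CARD('n))"
    proof (rule sum_mono)
      fix k
      have "norm (U $ k) \<le> (\<Sum>i\<in>UNIV. norm (U $ k $ i))"
        by (simp add: norm_vec_def L2_set_le_sum)
      also have "\<dots> \<le> (\<Sum>i\<in>(UNIV::'n set). 1)"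
        by (intro sum_mono entry)
      finally show "norm (U $ k) \<le> real CARD('n)" by simp
    qed
    finally show ?thesis by simp
  qed
  then show "bounded {U :: complex^'n^'n. unitary U}"
    by (auto intro!: boundedI)
  have "{U :: complex^'n^'n. unitary U} = {U. cadjoint U ** U = mat 1}"
    using unitaryI by (auto simp: unitary_def)
  moreover have "closed {U :: complex^'n^'n. cadjoint U ** U = mat 1}"
    unfolding matrix_matrix_mult_def cadjoint_def
    by (intro closed_Collect_eq continuous_intros)
  ultimately show "closed {U :: complex^'n^'n. unitary U}" by simp
qed

text \<open>The sum of all squared moduli of the entries is invariant under unitary conjugation, so
  for Hermitian matrices, whose diagonal is real, making this large means making the off-diagonal
  part small.\<close>

definition diag_weight :: "complex^'n^'n \<Rightarrow> real" where
  "diag_weight B = (\<Sum>i\<in>UNIV. (Re (B $ i $ i))\<^sup>2)"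

text \<open>In the application \<delta> is the difference of two diagonal entries and \<beta> the
  modulus of the entry coupling them. With x = cos (t/2) and y = sin (t/2) the expression is
  \<delta> cos t + 2 \<beta> sin t, and taking t as the polar angle of the vector (\<delta>, 2
  \<beta>) makes it the length of that vector.\<close>

lemma rotation_angle:
  fixes \<delta> \<beta> :: real
  assumes "\<beta> \<noteq> 0"
  obtains x y where "x\<^sup>2 + y\<^sup>2 = 1" "(\<delta> * (x\<^sup>2 - y\<^sup>2) + 4 * x * y * \<beta>)\<^sup>2 = \<delta>\<^sup>2 + 4 * \<beta>\<^sup>2"
proof -
  define h where "h = sqrt (\<delta>\<^sup>2 + 4 * \<beta>\<^sup>2)"
  have hpos: "\<delta>\<^sup>2 + 4 * \<beta>\<^sup>2 > 0"
    using assms by (simp add: add_nonneg_pos)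
  then have h: "h > 0" and h2: "h\<^sup>2 = \<delta>\<^sup>2 + 4 * \<beta>\<^sup>2"
    by (auto simp: h_def)
  have "(\<delta> / h)\<^sup>2 + (2 * \<beta> / h)\<^sup>2 = (\<delta>\<^sup>2 + 4 * \<beta>\<^sup>2) / h\<^sup>2"
    by (simp add: power_divide add_divide_distrib power_mult_distrib)
  also have "\<dots> = 1"
    unfolding h2[symmetric] using h by simp
  finally obtain t where t: "\<delta> / h = cos t" "2 * \<beta> / h = sin t"
    using sincos_total_2pi by metis
  let ?x = "cos (t / 2)" and ?y = "sin (t / 2)"
  have c: "?x\<^sup>2 - ?y\<^sup>2 = \<delta> / h" and s: "2 * ?x * ?y = 2 * \<beta> / h"
    using cos_double[of "t / 2"] sin_double[of "t / 2"] t by (simp_all add: mult_ac)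
  have "\<delta> * (?x\<^sup>2 - ?y\<^sup>2) + 4 * ?x * ?y * \<beta> = \<delta> * (?x\<^sup>2 - ?y\<^sup>2) + 2 * \<beta> * (2 * ?x * ?y)"
    by simp
  also have "\<dots> = (\<delta>\<^sup>2 + 4 * \<beta>\<^sup>2) / h"
    unfolding c s by (simp add: add_divide_distrib power2_eq_square)
  also have "\<dots> = h"
    using h unfolding h2[symmetric] by (simp add: power2_eq_square)
  finally show thesis
    using that[of ?x ?y] h2 by simp
qed

text \<open>Conjugation by a rotation in the plane of p and q keeps the other diagonal entries and
  the sum of these two, while the square of their difference grows by 4 \<beta>^2. The sum of their
  squares thus grows by 2 \<beta>^2.\<close>

lemma jacobi_rotation_improves:
  fixes B :: "complex^'n^'n"
  assumes B: "hermitian B" and pq: "p \<noteq> q" and nz: "B $ p $ q \<noteq> 0"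
  obtains G where "unitary G" "diag_weight (cadjoint G ** B ** G) > diag_weight B"
proof -
  define a d \<beta> e where "a = Re (B $ p $ p)" and "d = Re (B $ q $ q)"
    and "\<beta> = norm (B $ p $ q)" and "e = B $ p $ q / complex_of_real (norm (B $ p $ q))"
  have sym: "B $ i $ j = cnj (B $ j $ i)" for i j
    using B unfolding hermitian_def cadjoint_def by (metis vec_lambda_beta)
  have \<beta>: "\<beta> \<noteq> 0" using nz by (simp add: \<beta>_def)
  have pp: "B $ p $ p = complex_of_real a" and qq: "B $ q $ q = complex_of_real d"
    using sym[of p p] sym[of q q] by (simp_all add: a_def d_def complex_eq_iff)
  have bpq: "B $ p $ q = complex_of_real \<beta> * e" and ee: "e * cnj e = 1"
    using nz by (simp_all add: \<beta>_def e_def complex_norm_square[symmetric] power2_eq_square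
        flip: of_real_mult)
  have bqp: "B $ q $ p = complex_of_real \<beta> * cnj e"
    using sym[of q p] bpq by simp
  obtain x y where xy: "x\<^sup>2 + y\<^sup>2 = 1"
    and imp: "((a - d) * (x\<^sup>2 - y\<^sup>2) + 4 * x * y * \<beta>)\<^sup>2 = (a - d)\<^sup>2 + 4 * \<beta>\<^sup>2"
    using rotation_angle[OF \<beta>] by metis
  \<comment> \<open>The phase \<open>e\<close> makes the off-diagonal entry of the \<open>{p, q}\<close> block real; \<open>G\<close> then rotates that block.\<close>
  define G :: "complex^'n^'n" where "G = (\<chi> i j.
     if j = p then (if i = p then of_real x else if i = q then of_real y * cnj e else 0)
     else if j = q then (if i = p then - of_real y * e else if i = q then of_real x else 0)
     else if i = j then 1 else 0)"
  \<comment> \<open>Each column of \<open>G\<close> has at most two nonzero entries, so every sum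
    against a column collapses; with the conjugate form \<open>colsum'\<close> this evaluates all
    the matrix products below.\<close>
  have colsum: "(\<Sum>k\<in>UNIV. cnj (G $ k $ i) * g k) =
      (if i = p then of_real x * g p + of_real y * e * g q
       else if i = q then - of_real y * cnj e * g p + of_real x * g q else g i)" for i and g :: "'n \<Rightarrow> complex"
  proof (cases "i = p \<or> i = q")
    case True
    have "(\<Sum>k\<in>UNIV. cnj (G $ k $ i) * g k) = (\<Sum>k\<in>{p, q}. cnj (G $ k $ i) * g k)"
      by (rule sum.mono_neutral_right) (use True in \<open>auto simp: G_def\<close>)
    then show ?thesis using True pq by (auto simp: G_def)
  next
    case False
    have "(\<Sum>k\<in>UNIV. cnj (G $ k $ i) * g k) = (\<Sum>k\<in>{i}. cnj (G $ k $ i) * g k)"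
      by (rule sum.mono_neutral_right) (use False in \<open>auto simp: G_def\<close>)
    then show ?thesis using False by (auto simp: G_def)
  qed
  have colsum': "(\<Sum>k\<in>UNIV. g k * G $ k $ i) =
      (if i = p then of_real x * g p + of_real y * cnj e * g q
       else if i = q then - of_real y * e * g p + of_real x * g q else g i)" for i and g :: "'n \<Rightarrow> complex"
    using arg_cong[OF colsum[of i "\<lambda>k. cnj (g k)"], of cnj]
    by (simp add: cnj_sum mult.commute split: if_splits)
  have xy': "complex_of_real x * complex_of_real x + complex_of_real y * complex_of_real y = 1"
    using xy by (simp add: power2_eq_square flip: of_real_mult of_real_add)
  have U: "unitary G"
  proof (rule unitaryI)
    have "(\<Sum>k\<in>UNIV. cnj (G $ k $ i) * G $ k $ j) = (if i = j then 1 else 0)" for i j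
    proof -
      have "complex_of_real y * e * (complex_of_real y * cnj e) = of_real y * of_real y * (e * cnj e)"
        "complex_of_real y * cnj e * (complex_of_real y * e) = of_real y * of_real y * (e * cnj e)"
        by (simp_all add: mult_ac)
      note yy = this[unfolded ee mult_1_right]
      show ?thesis
        unfolding colsum using pq xy' by (auto simp: G_def yy add_ac)
    qed
    then show "cadjoint G ** G = mat 1"
      by (simp add: matrix_matrix_mult_def cadjoint_def mat_def vec_eq_iff)
  qed
  define C where "C = cadjoint G ** B ** G"
  have C: "C $ i $ i = (\<Sum>k\<in>UNIV. cnj (G $ k $ i) * (\<Sum>l\<in>UNIV. B $ k $ l * G $ l $ i))" for i
    unfolding C_def conj_component by (simp add: sum_distrib_left mult.assoc)
  have "C $ p $ p = of_real (a * x * x) + of_real (d * y * y) * (e * cnj e)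
      + of_real (2 * x * y * \<beta>) * (e * cnj e)"
    unfolding C colsum colsum' by (simp add: pp qq bpq bqp algebra_simps)
  then have Cpp: "Re (C $ p $ p) = a * x\<^sup>2 + d * y\<^sup>2 + 2 * x * y * \<beta>"
    unfolding ee by (simp add: power2_eq_square)
  have "C $ q $ q = of_real (a * y * y) * (e * cnj e) + of_real (d * x * x)
      - of_real (2 * x * y * \<beta>) * (e * cnj e)"
    unfolding C colsum colsum' using pq by (simp add: pp qq bpq bqp algebra_simps)
  then have Cqq: "Re (C $ q $ q) = a * y\<^sup>2 + d * x\<^sup>2 - 2 * x * y * \<beta>"
    unfolding ee by (simp add: power2_eq_square)
  have Cii: "C $ i $ i = B $ i $ i" if "i \<noteq> p" "i \<noteq> q" for i
    unfolding C colsum colsum' using that by simp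
  have split: "diag_weight X = (Re (X $ p $ p))\<^sup>2 + (Re (X $ q $ q))\<^sup>2
       + (\<Sum>i\<in>UNIV - {p, q}. (Re (X $ i $ i))\<^sup>2)" for X :: "complex^'n^'n"
  proof -
    have "diag_weight X = (\<Sum>i\<in>{p, q}. (Re (X $ i $ i))\<^sup>2) + (\<Sum>i\<in>UNIV - {p, q}. (Re (X $ i $ i))\<^sup>2)"
      unfolding diag_weight_def by (subst sum.subset_diff[of "{p, q}"]) auto
    then show ?thesis using pq by simp
  qed
  \<comment> \<open>Since the sum of the two entries is preserved (\<open>tr\<close>), this identity
    reduces the comparison to their squared difference, which \<open>imp\<close> evaluates.\<close>
  have two: "2 * (u\<^sup>2 + v\<^sup>2) = (u + v)\<^sup>2 + (u - v)\<^sup>2" for u v :: real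
    by (simp add: power2_eq_square algebra_simps)
  have tr: "Re (C $ p $ p) + Re (C $ q $ q) = a + d"
  proof -
    have "Re (C $ p $ p) + Re (C $ q $ q) = (a + d) * (x\<^sup>2 + y\<^sup>2)"
      unfolding Cpp Cqq by (simp add: algebra_simps)
    then show ?thesis using xy by simp
  qed
  have df: "Re (C $ p $ p) - Re (C $ q $ q) = (a - d) * (x\<^sup>2 - y\<^sup>2) + 4 * x * y * \<beta>"
    unfolding Cpp Cqq by (simp add: algebra_simps)
  have "2 * (a\<^sup>2 + d\<^sup>2) < 2 * ((Re (C $ p $ p))\<^sup>2 + (Re (C $ q $ q))\<^sup>2)"
    unfolding two[of a d] two[of "Re (C $ p $ p)" "Re (C $ q $ q)"] tr df imp using \<beta> by simp
  then have "diag_weight B < diag_weight C"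
    unfolding split using Cii by (simp add: a_def d_def)
  then show thesis using that U by (simp add: C_def)
qed

theorem hermitian_diagonalization:
  fixes A :: "complex^'n^'n"
  assumes A: "hermitian A"
  obtains U d where "unitary U" "A = U ** diag_real d ** cadjoint U"
proof -
  let ?J = "\<lambda>U. diag_weight (cadjoint U ** A ** U)"
  have "unitary (mat 1 :: complex^'n^'n)"
    by (simp add: unitary_def cadjoint_mat_1)
  then have "{U :: complex^'n^'n. unitary U} \<noteq> {}" by blast
  moreover have "continuous_on {U. unitary U} ?J"
    unfolding diag_weight_def conj_component by (intro continuous_intros)
  ultimately obtain U where U: "unitary U" and max: "\<And>V. unitary V \<Longrightarrow> ?J V \<le> ?J U"
    using continuous_attains_sup[OF compact_unitary, of ?J] by auto
  define B where "B = cadjoint U ** A ** U"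
  have hB: "hermitian B"
    using A by (simp add: hermitian_def B_def cadjoint_mult matrix_mul_assoc)
  have off: "B $ p $ q = 0" if pq: "p \<noteq> q" for p q
  proof (rule ccontr)
    assume "B $ p $ q \<noteq> 0"
    then obtain G where G: "unitary G" "diag_weight (cadjoint G ** B ** G) > diag_weight B"
      using jacobi_rotation_improves[OF hB pq] by metis
    have "cadjoint (U ** G) ** A ** (U ** G) = cadjoint G ** B ** G"
      by (simp add: B_def cadjoint_mult matrix_mul_assoc)
    then show False
      using max[OF unitary_mult[OF U G(1)]] G(2) by (simp add: B_def)
  qed
  have "cnj (B $ i $ i) = B $ i $ i" for i
    using hB unfolding hermitian_def cadjoint_def by (metis vec_lambda_beta)
  then have "B = diag_real (\<lambda>i. Re (B $ i $ i))"
    using off by (auto simp: diag_real_def vec_eq_iff complex_eq_iff)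
  moreover have "U ** B ** cadjoint U = (U ** cadjoint U) ** A ** (U ** cadjoint U)"
    by (simp add: B_def matrix_mul_assoc)
  then have "A = U ** B ** cadjoint U"
    using U by (simp add: unitary_def)
  ultimately show thesis using that U by metis
qed

section \<open>Test functions approximating boxes\<close>

text \<open>For \<open>p = 1\<close> this is the classical smooth function that is flat at 0. The
  polynomial factor in 1/t makes the family closed under differentiation, so one induction covers
  the derivatives of all orders.\<close>

definition flat_exp :: "real \<Rightarrow> real poly \<Rightarrow> real \<Rightarrow> real" where
  "flat_exp \<epsilon> p t = (if t > 0 then poly p (1 / t) * exp (- (\<epsilon> / t)) else 0)"

lemma tendsto_poly_mult_exp_neg:
  fixes p :: "real poly"
  assumes "\<epsilon> > 0"
  shows "((\<lambda>u. poly p u * exp (- (\<epsilon> * u))) \<longlongrightarrow> 0) at_top"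
proof -
  have "filterlim (\<lambda>u. \<epsilon> * u) at_top at_top"
    using assms by (simp add: filterlim_tendsto_pos_mult_at_top[OF tendsto_const _ filterlim_ident])
  then have "((\<lambda>u. (\<epsilon> * u) ^ i / exp (\<epsilon> * u)) \<longlongrightarrow> 0) at_top" for i
    by (rule filterlim_compose[OF tendsto_power_div_exp_0])
  \<comment> \<open>The coefficients are divided by powers of \<epsilon> so that each monomial
    becomes a power of the argument \<epsilon> u of the exponential.\<close>
  then have "((\<lambda>u. \<Sum>i\<le>degree p. coeff p i / \<epsilon> ^ i * ((\<epsilon> * u) ^ i / exp (\<epsilon> * u))) \<longlongrightarrow>
      (\<Sum>i\<le>degree p. coeff p i / \<epsilon> ^ i * 0)) at_top"
    by (intro tendsto_sum tendsto_mult tendsto_const)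
  moreover have "(\<Sum>i\<le>degree p. coeff p i / \<epsilon> ^ i * ((\<epsilon> * u) ^ i / exp (\<epsilon> * u)))
      = poly p u * exp (- (\<epsilon> * u))" for u
    using assms unfolding poly_altdef sum_distrib_right exp_minus
    by (intro sum.cong) (simp_all add: field_simps power_mult_distrib)
  ultimately show ?thesis by simp
qed

lemma flat_exp_tendsto_0:
  assumes "\<epsilon> > 0"
  shows "(flat_exp \<epsilon> p \<longlongrightarrow> 0) (at 0)"
proof -
  have "((\<lambda>t. poly p (inverse t) * exp (- (\<epsilon> * inverse t))) \<longlongrightarrow> 0) (at_right 0)"
    by (rule filterlim_compose[OF tendsto_poly_mult_exp_neg[OF assms] filterlim_inverse_at_top_right])
  then have "(flat_exp \<epsilon> p \<longlongrightarrow> 0) (at_right 0)"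
    by (rule Lim_transform_eventually)
      (auto simp: eventually_at_filter flat_exp_def field_simps)
  moreover have "(flat_exp \<epsilon> p \<longlongrightarrow> 0) (at_left 0)"
    by (rule Lim_transform_eventually[OF tendsto_const])
      (auto simp: eventually_at_filter flat_exp_def)
  ultimately show ?thesis
    by (simp add: filterlim_at_split)
qed

text \<open>Put u = 1/t, so that d/dt = - u^2 d/du. Applied to p(u) exp(- \<epsilon> u) this gives
  u^2 (\<epsilon> p - p')(u) exp(- \<epsilon> u), and \<open>[:0, 0, 1:]\<close> is the polynomial
  u^2.\<close>

lemma flat_exp_has_derivative:
  assumes "\<epsilon> > 0"
  shows "(flat_exp \<epsilon> p has_real_derivative
    flat_exp \<epsilon> ([:0, 0, 1:] * (smult \<epsilon> p - pderiv p)) t) (at t)"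
proof -
  consider "t > 0" | "t < 0" | "t = 0" by linarith
  then show ?thesis
  proof cases
    case 1
    have "((\<lambda>t. poly p (1 / t) * exp (- (\<epsilon> / t))) has_real_derivative
        flat_exp \<epsilon> ([:0, 0, 1:] * (smult \<epsilon> p - pderiv p)) t) (at t)"
      using 1 by (auto intro!: derivative_eq_intros poly_DERIV[THEN DERIV_chain2]
          simp: flat_exp_def field_simps power2_eq_square)
    then show ?thesis
      by (rule has_field_derivative_transform_within[where d = t]) (use 1 in \<open>auto simp: flat_exp_def dist_real_def\<close>)
  next
    case 2
    have "((\<lambda>t. 0) has_real_derivative
        flat_exp \<epsilon> ([:0, 0, 1:] * (smult \<epsilon> p - pderiv p)) t) (at t)"
      using 2 by (auto simp: flat_exp_def)
    then show ?thesis
      by (rule has_field_derivative_transform_within[where d = "- t"]) (use 2 in \<open>auto simp: flat_exp_def dist_real_def\<close>)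
  next
    case 3
    \<comment> \<open>The division by t in the difference quotient at 0 multiplies the polynomial by
      its variable, so the quotient is again of the form \<open>flat_exp\<close> and tends to
      0.\<close>
    have "(flat_exp \<epsilon> (pCons 0 p) \<longlongrightarrow> 0) (at 0)"
      by (rule flat_exp_tendsto_0[OF assms])
    then have "((\<lambda>h. (flat_exp \<epsilon> p (0 + h) - flat_exp \<epsilon> p 0) / h) \<longlongrightarrow> 0) (at 0)"
      by (rule Lim_transform_eventually) (auto simp: eventually_at_filter flat_exp_def)
    then have "(flat_exp \<epsilon> p has_real_derivative 0) (at 0)"
      by (simp add: DERIV_def)
    then show ?thesis using 3 by (simp add: flat_exp_def)
  qed
qed

section \<open>Closure properties of the class \<open>C_k\<close> and smooth bumps on boxes\<close>

lemma partial_deriv_eq: "(\<phi> has_derivative D) (at x) \<Longrightarrow> partial_deriv j \<phi> x = D (axis j 1)"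
  by (simp add: partial_deriv_def frechet_derivative_at[symmetric])

text \<open>Needed for the product rule: there one factor stays undifferentiated and has to be used
  at the lower order.\<close>

lemma C_k_Suc_imp: "C_k (Suc n) \<phi> \<Longrightarrow> C_k n \<phi>"
proof (induction n arbitrary: \<phi>)
  case 0
  then show ?case by (simp add: differentiable_imp_continuous_on)
next
  case (Suc n)
  then show ?case by (metis C_k.simps(2))
qed

lemma C_k_const: "C_k n (\<lambda>x. c)"
proof (induction n arbitrary: c)
  case (Suc n)
  have "partial_deriv j (\<lambda>x. c) = (\<lambda>x. 0)" for j
    by (rule ext) (simp add: partial_deriv_eq[OF has_derivative_const])
  then show ?case using Suc by simp
qed simp

lemma C_k_add: "C_k n \<phi> \<Longrightarrow> C_k n \<psi> \<Longrightarrow> C_k n (\<lambda>x. \<phi> x + \<psi> x)"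
proof (induction n arbitrary: \<phi> \<psi>)
  case 0
  then show ?case by (simp add: continuous_on_add)
next
  case (Suc n)
  then have d: "\<phi> differentiable at x" "\<psi> differentiable at x" for x
    by (simp_all add: differentiable_on_def)
  have "partial_deriv j (\<lambda>x. \<phi> x + \<psi> x) = (\<lambda>x. partial_deriv j \<phi> x + partial_deriv j \<psi> x)" for j
    using partial_deriv_eq[OF has_derivative_add[OF d[unfolded frechet_derivative_works]]]
    by (intro ext) (simp add: partial_deriv_def)
  then show ?case using Suc by (auto intro: differentiable_on_add)
qed

lemma C_k_mult: "C_k n \<phi> \<Longrightarrow> C_k n \<psi> \<Longrightarrow> C_k n (\<lambda>x. \<phi> x * \<psi> x)"
proof (induction n arbitrary: \<phi> \<psi>)
  case 0
  then show ?case by (simp add: continuous_on_mult)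
next
  case (Suc n)
  then have d: "\<phi> differentiable at x" "\<psi> differentiable at x" for x
    by (simp_all add: differentiable_on_def)
  have "partial_deriv j (\<lambda>x. \<phi> x * \<psi> x)
      = (\<lambda>x. \<phi> x * partial_deriv j \<psi> x + partial_deriv j \<phi> x * \<psi> x)" for j
    using partial_deriv_eq[OF has_derivative_mult[OF d[unfolded frechet_derivative_works]]]
    by (intro ext) (simp add: partial_deriv_def)
  moreover have "C_k n (\<lambda>x. \<phi> x * partial_deriv j \<psi> x + partial_deriv j \<phi> x * \<psi> x)" for j
    using Suc.prems C_k_Suc_imp by (intro C_k_add Suc.IH) auto
  ultimately show ?case using Suc.prems by (auto intro: differentiable_on_mult)
qed

lemma C_k_prod: "finite I \<Longrightarrow> (\<And>i. i \<in> I \<Longrightarrow> C_k n (\<phi> i)) \<Longrightarrow> C_k n (\<lambda>x. \<Prod>i\<in>I. \<phi> i x)"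
  by (induction I rule: finite_induct) (simp_all add: C_k_const C_k_mult)

text \<open>The induction must leave \<open>p\<close> free, because a partial derivative is a
  constant multiple of the same function with another polynomial.\<close>

lemma C_k_flat_exp:
  assumes "\<epsilon> > 0"
  shows "C_k n (\<lambda>x. flat_exp \<epsilon> p (s * x $ j + c))"
proof (induction n arbitrary: p)
  case 0
  have "isCont (flat_exp \<epsilon> p) t" for t
    using flat_exp_has_derivative[OF assms] DERIV_isCont by blast
  then have "continuous_on UNIV (flat_exp \<epsilon> p)"
    by (simp add: continuous_at_imp_continuous_on)
  then have "continuous_on UNIV (\<lambda>x :: real^3. flat_exp \<epsilon> p (s * x $ j + c))"
    by (rule continuous_on_compose2) (auto intro!: continuous_intros)
  then show ?case by simp
next
  case (Suc n)
  let ?q = "[:0, 0, 1:] * (smult \<epsilon> p - pderiv p)"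
  have lin: "((\<lambda>x :: real^3. s * x $ j + c) has_derivative (\<lambda>h. s * h $ j)) (at x)" for x
    by (auto intro!: derivative_eq_intros bounded_linear.has_derivative[OF bounded_linear_vec_nth])
  have D: "((\<lambda>x :: real^3. flat_exp \<epsilon> p (s * x $ j + c)) has_derivative
      (\<lambda>h. s * h $ j * flat_exp \<epsilon> ?q (s * x $ j + c))) (at x)" for x
    using DERIV_compose_FDERIV[OF flat_exp_has_derivative[OF assms] lin] .
  have "partial_deriv i (\<lambda>x. flat_exp \<epsilon> p (s * x $ j + c))
      = (\<lambda>x. (if i = j then s else 0) * flat_exp \<epsilon> ?q (s * x $ j + c))" for i
    by (intro ext) (auto simp: partial_deriv_eq[OF D] axis_def)
  then show ?case
    using Suc D by (auto simp: differentiable_on_def differentiable_def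
        intro!: C_k_mult C_k_const)
qed

text \<open>The two factors for coordinate j vanish beyond the two faces of the box orthogonal to
  that axis. Their arguments are spelled \<open>s * x $ j + c\<close> to fit
  \<open>C_k_flat_exp\<close>.\<close>

definition bump :: "real^3 \<Rightarrow> real^3 \<Rightarrow> real \<Rightarrow> real^3 \<Rightarrow> real" where
  "bump a b \<epsilon> x = (\<Prod>j\<in>UNIV. flat_exp \<epsilon> 1 (1 * x $ j + (- a $ j)) * flat_exp \<epsilon> 1 ((-1) * x $ j + b $ j))"

lemma flat_exp_1_bounds: "\<epsilon> > 0 \<Longrightarrow> 0 \<le> flat_exp \<epsilon> 1 t \<and> flat_exp \<epsilon> 1 t \<le> 1"
  by (simp add: flat_exp_def)

lemma bump_bounds:
  assumes "\<epsilon> > 0"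
  shows "0 \<le> bump a b \<epsilon> x" "bump a b \<epsilon> x \<le> 1"
  unfolding bump_def using flat_exp_1_bounds[OF assms]
  by (auto intro!: prod_nonneg prod_le_1 mult_le_one)

lemma bump_outside: "x \<notin> box a b \<Longrightarrow> bump a b \<epsilon> x = 0"
  by (force simp: bump_def mem_box_cart flat_exp_def)

lemma bump_test_function:
  assumes "\<epsilon> > 0"
  shows "test_function (bump a b \<epsilon>)"
proof -
  have "C_k n (bump a b \<epsilon>)" for n
    unfolding bump_def by (intro C_k_prod C_k_mult C_k_flat_exp assms) simp_all
  moreover have "{x. bump a b \<epsilon> x \<noteq> 0} \<subseteq> box a b"
    using bump_outside by blast
  then have "compact (closure {x. bump a b \<epsilon> x \<noteq> 0})"
    using bounded_subset[OF bounded_box] by simp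
  ultimately show ?thesis by (simp add: test_function_def)
qed

lemma bump_tendsto_indicator: "(\<lambda>n. bump a b (inverse (real (Suc n))) x) \<longlonglongrightarrow> indicator (box a b) x"
proof (cases "x \<in> box a b")
  case True
  have "(\<lambda>n. flat_exp (inverse (real (Suc n))) 1 t) \<longlonglongrightarrow> 1" if "t > 0" for t
  proof -
    have "(\<lambda>n. exp (- (inverse (real (Suc n)) / t))) \<longlonglongrightarrow> exp (- (0 / t))"
      using that by (intro tendsto_intros LIMSEQ_inverse_real_of_nat) simp
    then show ?thesis using that by (simp add: flat_exp_def)
  qed
  then have "(\<lambda>n. bump a b (inverse (real (Suc n))) x) \<longlonglongrightarrow> (\<Prod>j\<in>(UNIV::3 set). 1 * 1)"
    unfolding bump_def by (intro tendsto_prod tendsto_mult) (use True in \<open>auto simp: mem_box_cart\<close>)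
  then show ?thesis using True by simp
qed (simp add: bump_outside)

text \<open>Stated for a continuous function vanishing off a compact set, so that it applies to a
  test function and to its partial derivatives alike. Boundedness on \<open>C\<close> gives the
  domination.\<close>

lemma integrable_test_mult:
  fixes g :: "real^3 \<Rightarrow> complex"
  assumes "continuous_on UNIV \<phi>" "compact C" "\<And>x. x \<notin> C \<Longrightarrow> \<phi> x = 0"
    and g: "set_integrable lebesgue C g"
  shows "integrable lebesgue (\<lambda>x. complex_of_real (\<phi> x) * g x)"
proof -
  have "compact (\<phi> ` C)"
    using assms(1,2) by (meson compact_continuous_image continuous_on_subset subset_UNIV)
  then obtain B where B: "\<And>x. x \<in> C \<Longrightarrow> \<bar>\<phi> x\<bar> \<le> B"
    by (force dest: compact_imp_bounded simp: bounded_iff)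
  have m[measurable]: "\<phi> \<in> borel_measurable lebesgue"
    by (rule measurable_completion) (simp add: borel_measurable_continuous_onI[OF assms(1)])
  have gm[measurable]: "(\<lambda>x. indicator C x *\<^sub>R g x) \<in> borel_measurable lebesgue"
    using g by (auto simp: set_integrable_def)
  \<comment> \<open>Set integrability makes only the restriction of \<open>g\<close> to
    \<open>C\<close> measurable, so the indicator is inserted before measurability is asked
    for.\<close>
  have eq: "complex_of_real (\<phi> x) * g x = complex_of_real (\<phi> x) * (indicator C x *\<^sub>R g x)" for x
    using assms(3) by (auto simp: indicator_def)
  show ?thesis
    unfolding eq
  proof (rule Bochner_Integration.integrable_bound)
    show "integrable lebesgue (\<lambda>x. B *\<^sub>R (indicator C x *\<^sub>R g x))"
      using g unfolding set_integrable_def by (rule integrable_scaleR_right)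
    show "AE x in lebesgue. norm (complex_of_real (\<phi> x) * (indicator C x *\<^sub>R g x))
        \<le> norm (B *\<^sub>R (indicator C x *\<^sub>R g x))"
      using B by (intro AE_I2) (force simp: indicator_def norm_mult intro!: mult_right_mono)
  qed measurable
qed

section \<open>The fundamental lemma of the calculus of variations\<close>

lemma sigma_finite_lebesgue: "sigma_finite_measure (lebesgue :: 'a::euclidean_space measure)"
proof
  let ?A = "range (\<lambda>n::nat. box (- (real n *\<^sub>R One)) (real n *\<^sub>R One) :: 'a set)"
  have "\<Union> ?A = UNIV" by (rule UN_box_eq_UNIV)
  then show "\<exists>A. countable A \<and> A \<subseteq> sets lebesgue \<and> \<Union> A = space (lebesgue :: 'a measure)
      \<and> (\<forall>a\<in>A. emeasure lebesgue a \<noteq> \<infinity>)"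
    by (intro exI[of _ ?A]) auto
qed

text \<open>Bumps converge to indicators of boxes, so all integrals of \<open>g\<close> over boxes
  vanish. Boxes are stable under intersection and generate the Borel sets, hence a Dynkin argument
  passes to Borel sets, and null sets lead on to Lebesgue sets. A function with all these integrals
  0 vanishes almost everywhere.\<close>

lemma fundamental_lemma_variations:
  fixes g :: "real^3 \<Rightarrow> complex"
  assumes loc: "\<And>C. compact C \<Longrightarrow> set_integrable lebesgue C g"
    and test: "\<And>\<phi>. test_function \<phi> \<Longrightarrow> (LINT x|lebesgue. complex_of_real (\<phi> x) * g x) = 0"
  shows "AE x in lebesgue. g x = 0"
proof -
  have loc_box: "set_integrable lebesgue (box a b) g" for a b
    by (rule set_integrable_subset[OF loc[OF compact_cbox[of a b]]]) (auto simp: box_subset_cbox)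
  have box: "(LINT x:box a b|lebesgue. g x) = 0" for a b
  proof -
    let ?s = "\<lambda>n x. complex_of_real (bump a b (inverse (real (Suc n))) x) * g x"
    have "integrable lebesgue (?s n)" for n
      using bump_test_function[of "inverse (real (Suc n))" a b]
      by (intro integrable_test_mult[OF _ compact_cbox[of a b]] loc)
        (auto simp: test_function_def dest: spec[of _ 0] intro!: bump_outside
          dest!: subsetD[OF box_subset_cbox])
    then have m: "?s n \<in> borel_measurable lebesgue" for n by (rule borel_measurable_integrable)
    have "(\<lambda>n. LINT x|lebesgue. ?s n x) \<longlonglongrightarrow> (LINT x|lebesgue. indicator (box a b) x *\<^sub>R g x)"
    proof (rule integral_dominated_convergence[where w = "\<lambda>x. norm (indicator (box a b) x *\<^sub>R g x)"])
      show "AE x in lebesgue. (\<lambda>n. ?s n x) \<longlonglongrightarrow> indicator (box a b) x *\<^sub>R g x"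
        by (intro AE_I2) (auto simp: scaleR_conv_of_real simp del: of_nat_Suc intro!: tendsto_mult tendsto_of_real bump_tendsto_indicator)
      show "AE x in lebesgue. norm (?s n x) \<le> norm (indicator (box a b) x *\<^sub>R g x)" for n
        using bump_bounds[of "inverse (real (Suc n))" a b]
        by (intro AE_I2) (auto simp: indicator_def bump_outside norm_mult intro!: mult_left_le_one_le)
    qed (use m loc_box[unfolded set_integrable_def] in
        \<open>auto simp del: norm_scaleR of_nat_Suc intro!: integrable_norm\<close>)
    moreover have "(LINT x|lebesgue. ?s n x) = 0" for n
      by (rule test, rule bump_test_function) simp
    ultimately show ?thesis
      by (simp add: set_lebesgue_integral_def LIMSEQ_const_iff)
  qed
  \<comment> \<open>The complement step of the Dynkin argument needs integrability on the whole
    space. As \<open>g\<close> is only locally integrable, it is cut off to cubes exhausting the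
    space; a box meets such a cube in a box, so the basic case survives.\<close>
  define Q :: "nat \<Rightarrow> (real^3) set" where "Q n = box (- (real n *\<^sub>R One)) (real n *\<^sub>R One)" for n
  define gn where "gn n x = indicator (Q n) x *\<^sub>R g x" for n x
  have int: "integrable lebesgue (gn n)" for n
    using loc_box unfolding gn_def Q_def set_integrable_def by auto
  have int': "set_integrable lebesgue A (gn n)" if "A \<in> sets lebesgue" for n A
    unfolding set_integrable_def by (intro integrable_mult_indicator that int)
  let ?E = "range (\<lambda>(a, b). box a b :: (real^3) set)"
  have borel0: "(LINT x:A|lebesgue. gn n x) = 0" if "A \<in> sigma_sets UNIV ?E" for n A
  proof -
    have "Int_stable ?E" by (auto simp: Int_stable_def box_Int_box)
    from this subset_UNIV[of ?E, folded Pow_UNIV] that show ?thesis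
    proof (induction A rule: sigma_sets_induct_disjoint)
      case (basic A)
      then obtain a b where "A \<inter> Q n = box a b"
        unfolding Q_def using box_Int_box by (metis (no_types, lifting) case_prod_beta imageE)
      moreover have "(LINT x:A|lebesgue. gn n x) = (LINT x:A \<inter> Q n|lebesgue. g x)"
        by (simp add: set_lebesgue_integral_def gn_def indicator_inter_arith)
      ultimately show ?case using box by simp
    next
      case empty
      show ?case by (simp add: set_lebesgue_integral_def)
    next
      case (compl A)
      have A: "A \<in> sets lebesgue"
        using compl(1) by (metis borel_eq_box sets_completionI_sets sets_lborel sets_measure_of_conv Pow_UNIV top_greatest)
      have "(LINT x:A|lebesgue. gn n x) + (LINT x:UNIV - A|lebesgue. gn n x)
          = (LINT x:A \<union> (UNIV - A)|lebesgue. gn n x)"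
        by (subst set_integral_Un) (use A in \<open>auto intro!: int'\<close>)
      also have "\<dots> = (LINT x:Q n|lebesgue. g x)"
        by (simp add: set_lebesgue_integral_def gn_def)
      finally show ?case using compl box by (simp add: Q_def)
    next
      case (union A)
      have A: "A i \<in> sets lebesgue" for i
        using union(2) by (metis borel_eq_box sets_completionI_sets sets_lborel sets_measure_of_conv Pow_UNIV top_greatest range_subsetD)
      have "(LINT x:(\<Union>i. A i)|lebesgue. gn n x) = (\<Sum>i. LINT x:A i|lebesgue. gn n x)"
        by (rule lebesgue_integral_countable_add)
          (use A union(1) int' in \<open>auto simp: disjoint_family_on_def\<close>)
      then show ?case using union by simp
    qed
  qed
  have "AE x in lebesgue. gn n x = 0" for n
  proof (rule sigma_finite_measure.density_zero[OF sigma_finite_lebesgue int])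
    fix A :: "(real^3) set"
    assume "A \<in> sets lebesgue"
    \<comment> \<open>The Dynkin argument reaches Borel sets; a Lebesgue set differs from one of
      them by a subset of a Borel null set.\<close>
    then obtain S N N' where A: "A = S \<union> N" "N \<subseteq> N'" "N' \<in> null_sets lborel" "S \<in> sets lborel"
      by (auto elim: sets_completionE)
    have N': "AE x in lebesgue. x \<notin> N'"
      using A(3) by (intro AE_not_in null_sets_completionI)
    have "(LINT x:A|lebesgue. gn n x) = (LINT x:S|lebesgue. gn n x)"
      unfolding set_lebesgue_integral_def
    proof (rule integral_cong_AE)
      show "(\<lambda>x. indicat_real A x *\<^sub>R gn n x) \<in> borel_measurable lebesgue"
        "(\<lambda>x. indicat_real S x *\<^sub>R gn n x) \<in> borel_measurable lebesgue"
        using int' \<open>A \<in> sets lebesgue\<close> sets_completionI_sets[OF A(4)]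
        unfolding set_integrable_def by (auto intro: borel_measurable_integrable)
      show "AE x in lebesgue. indicat_real A x *\<^sub>R gn n x = indicat_real S x *\<^sub>R gn n x"
        using N' by eventually_elim (use A in \<open>auto simp: indicator_def\<close>)
    qed
    also have "\<dots> = 0"
      using A(4) by (intro borel0) (simp add: borel_eq_box)
    finally show "(LINT x:A|lebesgue. gn n x) = 0" .
  qed
  then have "AE x in lebesgue. \<forall>n. gn n x = 0"
    by (simp add: AE_all_countable)
  then show ?thesis
  proof eventually_elim
    case (elim x)
    obtain n where "x \<in> Q n"
      unfolding Q_def using UN_box_eq_UNIV by blast
    then show ?case using elim[rule_format, of n] by (simp add: gn_def)
  qed
qed

section \<open>Locally square integrable functions\<close>

lemma L2_locI:
  fixes u :: "real^3 \<Rightarrow> 'b::euclidean_space"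
  assumes "u \<in> borel_measurable lebesgue"
    and "\<And>C. compact C \<Longrightarrow> set_integrable lebesgue C v" "\<And>x. (norm (u x))\<^sup>2 \<le> v x"
  shows "L2_loc u"
  unfolding L2_loc_def
proof (intro conjI allI impI assms(1))
  fix C :: "(real^3) set"
  assume C: "compact C"
  then have [measurable]: "C \<in> sets lebesgue"
    using lmeasurable_compact fmeasurableD by blast
  have [measurable]: "u \<in> borel_measurable lebesgue" by (rule assms(1))
  show "set_integrable lebesgue C (\<lambda>x. (norm (u x))\<^sup>2)"
    by (rule set_integrable_bound[OF assms(2)[OF C]])
      (use assms(3) order_trans[OF _ abs_ge_self] in \<open>auto simp: set_borel_measurable_def\<close>)
qed

lemma L2_loc_add:
  fixes u v :: "real^3 \<Rightarrow> 'b::euclidean_space"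
  assumes "L2_loc u" "L2_loc v"
  shows "L2_loc (\<lambda>x. u x + v x)"
proof (rule L2_locI)
  show "(\<lambda>x. u x + v x) \<in> borel_measurable lebesgue"
    using assms by (intro borel_measurable_add) (auto simp: L2_loc_def)
  show "set_integrable lebesgue C (\<lambda>x. 2 * (norm (u x))\<^sup>2 + 2 * (norm (v x))\<^sup>2)" if "compact C" for C
    using assms that by (intro set_integral_add set_integrable_mult_right) (auto simp: L2_loc_def)
  show "(norm (u x + v x))\<^sup>2 \<le> 2 * (norm (u x))\<^sup>2 + 2 * (norm (v x))\<^sup>2" for x
  proof -
    have "(norm (u x + v x))\<^sup>2 \<le> (norm (u x) + norm (v x))\<^sup>2"
      by (intro power_mono norm_triangle_ineq norm_ge_zero)
    also have "\<dots> \<le> 2 * (norm (u x))\<^sup>2 + 2 * (norm (v x))\<^sup>2"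
      using sum_squares_bound[of "norm (u x)" "norm (v x)"] by (simp add: power2_sum)
    finally show ?thesis .
  qed
qed

lemma L2_loc_zero: "L2_loc (\<lambda>x. 0)"
  by (simp add: L2_loc_def)

lemma L2_loc_cmult:
  fixes u :: "real^3 \<Rightarrow> complex"
  assumes "L2_loc u"
  shows "L2_loc (\<lambda>x. c * u x)"
proof (rule L2_locI)
  show "set_integrable lebesgue C (\<lambda>x. (norm c)\<^sup>2 * (norm (u x))\<^sup>2)" if "compact C" for C
    using assms that by (intro set_integrable_mult_right) (auto simp: L2_loc_def)
qed (use assms in \<open>auto simp: L2_loc_def norm_mult power_mult_distrib\<close>)

lemma L2_loc_sum:
  fixes u :: "'i \<Rightarrow> real^3 \<Rightarrow> 'b::euclidean_space"
  assumes "\<And>i. i \<in> I \<Longrightarrow> L2_loc (u i)"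
  shows "L2_loc (\<lambda>x. \<Sum>i\<in>I. u i x)"
  using assms
  by (induction I rule: infinite_finite_induct) (auto intro: L2_loc_add simp: L2_loc_zero)

lemma L2_loc_cnj: "L2_loc u \<Longrightarrow> L2_loc (\<lambda>x. cnj (u x))"
  unfolding L2_loc_def complex_mod_cnj
  by (auto intro: borel_measurable_continuous_on[where f = cnj] continuous_intros)

lemma L2_loc_vec_nth:
  fixes G :: "real^3 \<Rightarrow> complex^3"
  assumes "L2_loc G"
  shows "L2_loc (\<lambda>x. G x $ l)"
proof (rule L2_locI)
  show "set_integrable lebesgue C (\<lambda>x. (norm (G x))\<^sup>2)" if "compact C" for C
    using assms that by (auto simp: L2_loc_def)
  show "(\<lambda>x. G x $ l) \<in> borel_measurable lebesgue"
    using assms by (intro borel_measurable_continuous_on[where f = "\<lambda>v. v $ l"])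
      (auto simp: L2_loc_def intro!: continuous_intros)
qed (simp add: Finite_Cartesian_Product.norm_nth_le power_mono)

lemma L2_loc_axis:
  fixes u :: "real^3 \<Rightarrow> complex"
  assumes "L2_loc u"
  shows "L2_loc (\<lambda>x. axis l (u x) :: complex^3)"
proof (rule L2_locI)
  show "set_integrable lebesgue C (\<lambda>x. (norm (u x))\<^sup>2)" if "compact C" for C
    using assms that by (auto simp: L2_loc_def)
  have "continuous_on UNIV (axis l :: complex \<Rightarrow> complex^3)"
    unfolding axis_def
  proof (intro continuous_on_vec_lambda)
    show "continuous_on UNIV (\<lambda>x :: complex. if i = l then x else 0)" for i
      by (cases "i = l") simp_all
  qed
  then show "(\<lambda>x. axis l (u x) :: complex^3) \<in> borel_measurable lebesgue"
    using assms by (auto simp: L2_loc_def intro: borel_measurable_continuous_on)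
  have "norm (axis l (u x) :: complex^3) = norm (u x)" for x
    by (simp add: norm_vec_def L2_set_def axis_def if_distrib[of norm] if_distrib[of "\<lambda>y. y\<^sup>2"]
        cong: if_cong)
  then show "(norm (axis l (u x) :: complex^3))\<^sup>2 \<le> (norm (u x))\<^sup>2" for x
    by simp
qed

text \<open>Splitting a vector into its multiples of unit vectors reduces this to closure under
  sums.\<close>

lemma L2_loc_vec_lambda:
  fixes u :: "3 \<Rightarrow> real^3 \<Rightarrow> complex"
  assumes "\<And>l. L2_loc (u l)"
  shows "L2_loc (\<lambda>x. (\<chi> l. u l x) :: complex^3)"
proof -
  have "((\<chi> l. u l x) :: complex^3) = (\<Sum>l\<in>UNIV. axis l (u l x))" for x
    by (simp add: vec_eq_iff axis_def if_distrib[of "\<lambda>y. y * _"] cong: if_cong)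
  then show ?thesis
    using L2_loc_sum[of UNIV "\<lambda>l x. axis l (u l x) :: complex^3"] L2_loc_axis assms by simp
qed

text \<open>Pointwise |u v| is at most |u|^2 + |v|^2. Since \<open>L2_loc\<close> speaks of compact
  sets while \<Omega> may fail to be closed, the bound is used on a closed box containing \<Omega>
  and then restricted.\<close>

lemma L2_loc_mult_integrable:
  fixes u v :: "real^3 \<Rightarrow> complex"
  assumes u: "L2_loc u" and v: "L2_loc v" and \<Omega>: "bounded \<Omega>" "\<Omega> \<in> sets lebesgue"
  shows "set_integrable lebesgue \<Omega> (\<lambda>x. u x * v x)"
proof -
  obtain a b where ab: "\<Omega> \<subseteq> cbox a b"
    using \<Omega>(1) bounded_subset_cbox_symmetric by blast
  have m: "u \<in> borel_measurable lebesgue" "v \<in> borel_measurable lebesgue"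
    using u v by (auto simp: L2_loc_def)
  have "set_integrable lebesgue (cbox a b) (\<lambda>x. (norm (u x))\<^sup>2 + (norm (v x))\<^sup>2)"
    using u v by (intro set_integral_add) (auto simp: L2_loc_def)
  then have "set_integrable lebesgue (cbox a b) (\<lambda>x. u x * v x)"
  proof (rule set_integrable_bound)
    show "set_borel_measurable lebesgue (cbox a b) (\<lambda>x. u x * v x)"
      unfolding set_borel_measurable_def
      by (intro borel_measurable_scaleR borel_measurable_times borel_measurable_indicator m) simp
    have "norm (u x * v x) \<le> (norm (u x))\<^sup>2 + (norm (v x))\<^sup>2" for x
      using sum_squares_bound[of "norm (u x)" "norm (v x)"] mult_nonneg_nonneg[OF norm_ge_zero[of "u x"] norm_ge_zero[of "v x"]]
      by (simp only: norm_mult)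
    then show "AE x in lebesgue. x \<in> cbox a b \<longrightarrow>
        norm (u x * v x) \<le> norm ((norm (u x))\<^sup>2 + (norm (v x))\<^sup>2)"
      by auto
  qed
  then show ?thesis
    by (rule set_integrable_subset) (use ab \<Omega> in auto)
qed

lemma L2_loc_integrable:
  fixes u :: "real^3 \<Rightarrow> complex"
  assumes "L2_loc u" "compact C"
  shows "set_integrable lebesgue C u"
proof -
  have "L2_loc (\<lambda>x :: real^3. 1 :: complex)"
    unfolding L2_loc_def
    using lmeasurable_compact[THEN lmeasurable_iff_integrable[THEN iffD1]]
    by (auto simp: set_integrable_def)
  then show ?thesis
    using L2_loc_mult_integrable[OF assms(1) _ compact_imp_bounded[OF assms(2)], of "\<lambda>x. 1"]
      lmeasurable_compact[OF assms(2)] by (simp add: fmeasurableD)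
qed

section \<open>Weak gradients of linear combinations\<close>

lemma
  assumes "test_function \<phi>" and u: "L2_loc u"
  shows integrable_test: "integrable lebesgue (\<lambda>x. complex_of_real (\<phi> x) * u x)"
    and integrable_partial_deriv_test:
      "integrable lebesgue (\<lambda>x. complex_of_real (partial_deriv j \<phi> x) * u x)"
proof -
  obtain C where C: "compact C" and out: "\<And>x. x \<notin> C \<Longrightarrow> \<phi> x = 0"
  proof
    show "compact (closure {x. \<phi> x \<noteq> 0})"
      using assms(1) by (simp add: test_function_def)
    show "\<phi> x = 0" if "x \<notin> closure {x. \<phi> x \<noteq> 0}" for x
      using closure_subset[of "{x. \<phi> x \<noteq> 0}"] that by auto
  qed
  have "C_k 0 \<phi>" "C_k (Suc 0) \<phi>"
    using assms(1) unfolding test_function_def by blast+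
  then have k: "continuous_on UNIV \<phi>" "continuous_on UNIV (partial_deriv j \<phi>)"
    by simp_all
  \<comment> \<open>The complement of \<open>C\<close> is open and \<phi> vanishes on it, so \<phi>
    agrees with 0 near x.\<close>
  have "partial_deriv j \<phi> x = 0" if "x \<notin> C" for x
  proof -
    have "((\<lambda>x. 0) has_derivative (\<lambda>h. 0)) (at x)" by simp
    then have "(\<phi> has_derivative (\<lambda>h. 0)) (at x)"
      by (rule has_derivative_transform_within_open[where s = "- C"])
        (simp_all only: open_Compl[OF compact_imp_closed[OF C]] Compl_iff that out not_False_eq_True)
    then show ?thesis by (simp add: partial_deriv_eq)
  qed
  then show "integrable lebesgue (\<lambda>x. complex_of_real (partial_deriv j \<phi> x) * u x)"
    by (rule integrable_test_mult[OF k(2) C _ L2_loc_integrable[OF u C]])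
  show "integrable lebesgue (\<lambda>x. complex_of_real (\<phi> x) * u x)"
    by (rule integrable_test_mult[OF k(1) C out L2_loc_integrable[OF u C]])
qed

lemma weak_gradient_unique:
  assumes G: "is_weak_gradient u G" and H: "is_weak_gradient u H"
  shows "AE x in lebesgue. G x = H x"
proof -
  have "AE x in lebesgue. G x $ j - H x $ j = 0" for j
  proof (rule fundamental_lemma_variations)
    have L: "L2_loc (\<lambda>x. G x $ j)" "L2_loc (\<lambda>x. H x $ j)"
      using G H by (auto simp: is_weak_gradient_def intro: L2_loc_vec_nth)
    show "set_integrable lebesgue C (\<lambda>x. G x $ j - H x $ j)" if "compact C" for C
      using L that by (intro set_integral_diff L2_loc_integrable)
    show "(LINT x|lebesgue. complex_of_real (\<phi> x) * (G x $ j - H x $ j)) = 0"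
      if "test_function \<phi>" for \<phi>
    proof -
      have "(LINT x|lebesgue. complex_of_real (\<phi> x) * G x $ j)
          = (LINT x|lebesgue. complex_of_real (\<phi> x) * H x $ j)"
        using G[unfolded is_weak_gradient_def, THEN conjunct2, rule_format, OF that, of j]
          H[unfolded is_weak_gradient_def, THEN conjunct2, rule_format, OF that, of j] by simp
      then show ?thesis
        using integrable_test[OF that] L by (simp add: right_diff_distrib)
    qed
  qed
  then have "AE x in lebesgue. \<forall>j. G x $ j - H x $ j = 0"
    by (simp add: eventually_all_finite)
  then show ?thesis
    by eventually_elim (simp add: vec_eq_iff)
qed

text \<open>Both sides of the defining identity are linear once the integrals exist, and they do
  because test functions and their partial derivatives are continuous with compact support.\<close>

lemma is_weak_gradient_sum:
  fixes u :: "'i::finite \<Rightarrow> real^3 \<Rightarrow> complex"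
  assumes u: "\<And>i. L2_loc (u i)" and G: "\<And>i. is_weak_gradient (u i) (G i)"
  shows "is_weak_gradient (\<lambda>x. \<Sum>i\<in>UNIV. c i * u i x) (\<lambda>x. \<chi> l. \<Sum>i\<in>UNIV. c i * G i x $ l)"
  unfolding is_weak_gradient_def
proof (intro conjI allI impI)
  have L: "L2_loc (\<lambda>x. G i x $ j)" for i j
    using G by (auto simp: is_weak_gradient_def intro: L2_loc_vec_nth)
  then show "L2_loc (\<lambda>x. (\<chi> l. \<Sum>i\<in>UNIV. c i * G i x $ l) :: complex^3)"
    by (intro L2_loc_vec_lambda L2_loc_sum L2_loc_cmult)
  fix \<phi> j
  assume \<phi>: "test_function \<phi>"
  have "(LINT x|lebesgue. complex_of_real (partial_deriv j \<phi> x) * (\<Sum>i\<in>UNIV. c i * u i x))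
      = (LINT x|lebesgue. (\<Sum>i\<in>UNIV. c i * (complex_of_real (partial_deriv j \<phi> x) * u i x)))"
    by (simp add: sum_distrib_left mult_ac)
  also have "\<dots> = (\<Sum>i\<in>UNIV. c i * (LINT x|lebesgue. complex_of_real (partial_deriv j \<phi> x) * u i x))"
    using integrable_partial_deriv_test[OF \<phi> u] by simp
  also have "\<dots> = (\<Sum>i\<in>UNIV. c i * - (LINT x|lebesgue. complex_of_real (\<phi> x) * G i x $ j))"
    using G \<phi> by (simp add: is_weak_gradient_def)
  also have "\<dots> = - (LINT x|lebesgue. (\<Sum>i\<in>UNIV. c i * (complex_of_real (\<phi> x) * G i x $ j)))"
    using integrable_test[OF \<phi> L] by (simp add: sum_negf)
  also have "\<dots> = - (LINT x|lebesgue. complex_of_real (\<phi> x) * (\<chi> l. \<Sum>i\<in>UNIV. c i * G i x $ l) $ j)"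
    by (simp add: sum_distrib_left mult_ac)
  finally show "(LINT x|lebesgue. complex_of_real (partial_deriv j \<phi> x) * (\<Sum>i\<in>UNIV. c i * u i x))
      = - (LINT x|lebesgue. complex_of_real (\<phi> x) * (\<chi> l. \<Sum>i\<in>UNIV. c i * G i x $ l) $ j)" .
qed

lemma weak_gradient_is_weak_gradient: "is_weak_gradient u G \<Longrightarrow> is_weak_gradient u (weak_gradient u)"
  unfolding weak_gradient_def by (rule someI[where P = "is_weak_gradient u"])

lemma H1_per_L2_loc: "u \<in> H1_per R \<Longrightarrow> L2_loc u"
  by (simp add: H1_per_def L2_per_def)

lemma H1_per_weak_gradient: "u \<in> H1_per R \<Longrightarrow> is_weak_gradient u (weak_gradient u)"
  by (auto simp: H1_per_def intro: weak_gradient_is_weak_gradient)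

lemma k_gradient_L2_loc:
  assumes "L2_loc u" "is_weak_gradient u G"
  shows "L2_loc (\<lambda>r. k_gradient k u r $ l)"
  using assms(1) weak_gradient_is_weak_gradient[OF assms(2)]
  by (auto simp: k_gradient_def is_weak_gradient_def mult.assoc
      intro!: L2_loc_add L2_loc_cmult L2_loc_vec_nth)

text \<open>The l-th component of ik + \<nabla> applied to a tuple. It turns the kinetic matrix into
  half a sum of Gram matrices, so that covariance of \<open>gram\<close> handles it too.\<close>

definition k_partial :: "real^3 \<Rightarrow> 3 \<Rightarrow> (real^3 \<Rightarrow> complex)^'n \<Rightarrow> (real^3 \<Rightarrow> complex)^'n" where
  "k_partial k l \<Psi> = (\<chi> i. (\<lambda>r. k_gradient k (\<Psi> $ i) r $ l))"

lemma tuple_mult_L2_loc: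
  assumes "\<And>i. L2_loc (\<Psi> $ i)"
  shows "L2_loc (tuple_mult \<Psi> A $ j)"
  unfolding tuple_mult_def using assms by (simp add: L2_loc_sum L2_loc_cmult)

lemma tuple_mult_weak_gradient:
  assumes "\<And>i. \<Psi> $ i \<in> H1_per R"
  shows "is_weak_gradient (tuple_mult \<Psi> A $ j)
    (\<lambda>x. \<chi> l. \<Sum>i\<in>UNIV. A $ i $ j * weak_gradient (\<Psi> $ i) x $ l)"
  unfolding tuple_mult_def vec_lambda_beta
  using assms by (intro is_weak_gradient_sum H1_per_L2_loc H1_per_weak_gradient)

lemma k_partial_tuple_mult:
  assumes "\<And>i. \<Psi> $ i \<in> H1_per R"
  shows "AE r in lebesgue. (k_partial k l (tuple_mult \<Psi> A) $ j) r = (tuple_mult (k_partial k l \<Psi>) A $ j) r"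
proof -
  have "AE x in lebesgue. weak_gradient (tuple_mult \<Psi> A $ j) x
      = (\<chi> l. \<Sum>i\<in>UNIV. A $ i $ j * weak_gradient (\<Psi> $ i) x $ l)"
    using weak_gradient_unique weak_gradient_is_weak_gradient tuple_mult_weak_gradient[OF assms] by blast
  then show ?thesis
    by eventually_elim
      (simp add: k_partial_def k_gradient_def tuple_mult_def sum_distrib_left sum.distrib algebra_simps)
qed

section \<open>Covariance of the Gram matrices\<close>

text \<open>This is sesquilinearity of the inner product; square integrability on the bounded cell
  allows the finite double sum to leave the integral.\<close>

lemma gram_tuple_mult:
  fixes \<Psi> :: "(real^3 \<Rightarrow> complex)^'p" and \<Phi> :: "(real^3 \<Rightarrow> complex)^'q"
  assumes \<Omega>: "bounded \<Omega>" "\<Omega> \<in> sets lebesgue"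
    and L: "\<And>i. L2_loc (\<Psi> $ i)" "\<And>i. L2_loc (\<Phi> $ i)"
  shows "gram \<Omega> (tuple_mult \<Psi> A) (tuple_mult \<Phi> B) = cadjoint A ** gram \<Omega> \<Psi> \<Phi> ** B"
proof -
  have int: "set_integrable lebesgue \<Omega> (\<lambda>r. cnj ((\<Psi> $ k) r) * (\<Phi> $ l) r)" for k l
    by (intro L2_loc_mult_integrable L2_loc_cnj L \<Omega>)
  have "gram \<Omega> (tuple_mult \<Psi> A) (tuple_mult \<Phi> B) $ i $ j = (cadjoint A ** gram \<Omega> \<Psi> \<Phi> ** B) $ i $ j" for i j
  proof -
    have "gram \<Omega> (tuple_mult \<Psi> A) (tuple_mult \<Phi> B) $ i $ j
      = (LINT r:\<Omega>|lebesgue. \<Sum>l\<in>UNIV. \<Sum>k\<in>UNIV. cnj (A $ k $ i) * B $ l $ j * (cnj ((\<Psi> $ k) r) * (\<Phi> $ l) r))"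
      by (simp add: gram_def cell_inner_def tuple_mult_def sum_product mult_ac sum.swap[of _ "UNIV :: 'p set"])
    also have "\<dots> = (\<Sum>l\<in>UNIV. \<Sum>k\<in>UNIV. cnj (A $ k $ i) * B $ l $ j * cell_inner \<Omega> (\<Psi> $ k) (\<Phi> $ l))"
    proof -
      have "integrable lebesgue (\<lambda>r. c * (indicator \<Omega> r *\<^sub>R (cnj ((\<Psi> $ k) r) * (\<Phi> $ l) r)))" for k l and c :: complex
        using int[unfolded set_integrable_def] by (intro integrable_mult_right)
      then show ?thesis
        by (simp add: cell_inner_def set_lebesgue_integral_def scaleR_sum_right flip: mult_scaleR_right)
    qed
    also have "\<dots> = (cadjoint A ** gram \<Omega> \<Psi> \<Phi> ** B) $ i $ j"
      by (simp add: matrix_matrix_mult_def cadjoint_def gram_def sum_distrib_left mult_ac)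
    finally show ?thesis .
  qed
  then show ?thesis by (simp add: vec_eq_iff)
qed

lemma gram_cong_AE:
  assumes \<Omega>: "bounded \<Omega>" "\<Omega> \<in> sets lebesgue"
    and L: "\<And>i. L2_loc (\<Psi> $ i)" "\<And>i. L2_loc (\<Phi> $ i)" "\<And>i. L2_loc (\<Psi>' $ i)" "\<And>i. L2_loc (\<Phi>' $ i)"
    and eq: "\<And>i. AE r in lebesgue. (\<Psi> $ i) r = (\<Psi>' $ i) r" "\<And>i. AE r in lebesgue. (\<Phi> $ i) r = (\<Phi>' $ i) r"
  shows "gram \<Omega> \<Psi> \<Phi> = gram \<Omega> \<Psi>' \<Phi>'"
proof -
  have "cell_inner \<Omega> (\<Psi> $ i) (\<Phi> $ j) = cell_inner \<Omega> (\<Psi>' $ i) (\<Phi>' $ j)" for i j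
    unfolding cell_inner_def set_lebesgue_integral_def
  proof (rule integral_cong_AE)
    show "(\<lambda>x. indicat_real \<Omega> x *\<^sub>R (cnj ((\<Psi> $ i) x) * (\<Phi> $ j) x)) \<in> borel_measurable lebesgue"
      "(\<lambda>x. indicat_real \<Omega> x *\<^sub>R (cnj ((\<Psi>' $ i) x) * (\<Phi>' $ j) x)) \<in> borel_measurable lebesgue"
      using L2_loc_mult_integrable[OF L2_loc_cnj[OF L(1)] L(2) \<Omega>]
        L2_loc_mult_integrable[OF L2_loc_cnj[OF L(3)] L(4) \<Omega>]
      unfolding set_integrable_def by (auto intro: borel_measurable_integrable)
    show "AE x in lebesgue. indicat_real \<Omega> x *\<^sub>R (cnj ((\<Psi> $ i) x) * (\<Phi> $ j) x)
        = indicat_real \<Omega> x *\<^sub>R (cnj ((\<Psi>' $ i) x) * (\<Phi>' $ j) x)"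
      using eq(1)[of i] eq(2)[of j] by eventually_elim simp
  qed
  then show ?thesis by (simp add: gram_def)
qed

lemma kinetic_matrix_eq:
  assumes \<Omega>: "bounded \<Omega>" "\<Omega> \<in> sets lebesgue"
    and L: "\<And>i l. L2_loc (k_partial k l \<Psi> $ i)"
  shows "kinetic_matrix \<Omega> k \<Psi> $ i $ j
    = 1/2 * (\<Sum>l\<in>UNIV. gram \<Omega> (k_partial k l \<Psi>) (k_partial k l \<Psi>) $ i $ j)"
proof -
  have "integrable lebesgue (\<lambda>r. indicator \<Omega> r *\<^sub>R (cnj (k_gradient k (\<Psi> $ i) r $ l) * k_gradient k (\<Psi> $ j) r $ l))" for l
    using L2_loc_mult_integrable[OF L2_loc_cnj[OF L[of l i]] L[of l j] \<Omega>]
    by (simp add: k_partial_def set_integrable_def)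
  then show ?thesis
    unfolding kinetic_matrix_def gram_def cell_inner_def k_partial_def set_lebesgue_integral_def
      vec_lambda_beta scaleR_sum_right
    by (subst Bochner_Integration.integral_sum) simp_all
qed

lemma kinetic_matrix_tuple_mult:
  assumes \<Omega>: "bounded \<Omega>" "\<Omega> \<in> sets lebesgue" and \<Psi>: "\<And>i. \<Psi> $ i \<in> H1_per R"
  shows "kinetic_matrix \<Omega> k (tuple_mult \<Psi> A) = cadjoint A ** kinetic_matrix \<Omega> k \<Psi> ** A"
proof -
  let ?g = "\<lambda>l. gram \<Omega> (k_partial k l \<Psi>) (k_partial k l \<Psi>)"
  have L: "L2_loc (k_partial k l \<Psi> $ i)" for l i
    using k_gradient_L2_loc[OF H1_per_L2_loc[OF \<Psi>] H1_per_weak_gradient[OF \<Psi>]]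
    by (simp add: k_partial_def)
  have LA: "L2_loc (k_partial k l (tuple_mult \<Psi> A) $ i)" for l i
    using k_gradient_L2_loc[OF tuple_mult_L2_loc[OF H1_per_L2_loc[OF \<Psi>]] tuple_mult_weak_gradient[OF \<Psi>]]
    by (simp add: k_partial_def)
  \<comment> \<open>The chosen gradient of a combination and the combination of the chosen gradients
    may differ on a null set, which the Gram matrix does not see.\<close>
  have g: "gram \<Omega> (k_partial k l (tuple_mult \<Psi> A)) (k_partial k l (tuple_mult \<Psi> A)) = cadjoint A ** ?g l ** A" for l
    unfolding gram_tuple_mult[OF \<Omega> L L, symmetric]
    by (intro gram_cong_AE \<Omega> L LA k_partial_tuple_mult[OF \<Psi>] tuple_mult_L2_loc)
  have "kinetic_matrix \<Omega> k (tuple_mult \<Psi> A) $ i $ j = (cadjoint A ** kinetic_matrix \<Omega> k \<Psi> ** A) $ i $ j" for i j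
  proof -
    have "kinetic_matrix \<Omega> k (tuple_mult \<Psi> A) $ i $ j
        = (\<Sum>l\<in>UNIV. \<Sum>p\<in>UNIV. \<Sum>q\<in>UNIV. cnj (A $ p $ i) * (1/2 * ?g l $ p $ q) * A $ q $ j)"
      unfolding kinetic_matrix_eq[OF \<Omega> LA] g conj_component by (simp add: sum_distrib_left)
    also have "\<dots> = (\<Sum>p\<in>UNIV. \<Sum>q\<in>UNIV. \<Sum>l\<in>UNIV. cnj (A $ p $ i) * (1/2 * ?g l $ p $ q) * A $ q $ j)"
      by (subst sum.swap) (intro sum.cong refl sum.swap)
    also have "\<dots> = (cadjoint A ** kinetic_matrix \<Omega> k \<Psi> ** A) $ i $ j"
      unfolding conj_component kinetic_matrix_eq[OF \<Omega> L] by (simp add: sum_distrib_left sum_distrib_right)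
    finally show ?thesis .
  qed
  then show ?thesis by (simp add: vec_eq_iff)
qed

section \<open>Covariance of the nonlocal potential and of the pointwise products\<close>

lemma tuple_mult_mat_1: "tuple_mult \<Psi> (mat 1) = \<Psi>"
  by (simp add: tuple_mult_def mat_def vec_eq_iff fun_eq_iff if_distrib[of "\<lambda>y. y * _"] cong: if_cong)

lemma tuple_mult_assoc: "tuple_mult \<Psi> (A ** B) = tuple_mult (tuple_mult \<Psi> A) B"
proof -
  have "(\<Sum>i\<in>UNIV. (\<Sum>k\<in>UNIV. A $ i $ k * B $ k $ j) * (\<Psi> $ i) r)
      = (\<Sum>k\<in>UNIV. B $ k $ j * (\<Sum>i\<in>UNIV. A $ i $ k * (\<Psi> $ i) r))" for j r
    unfolding sum_distrib_left sum_distrib_right by (subst sum.swap) (simp add: mult_ac)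
  then show ?thesis
    by (simp add: tuple_mult_def matrix_matrix_mult_def vec_eq_iff)
qed

lemma gram_tuple_mult_left:
  assumes "bounded \<Omega>" "\<Omega> \<in> sets lebesgue" "\<And>i. L2_loc (\<Psi> $ i)" "\<And>i. L2_loc (\<Phi> $ i)"
  shows "gram \<Omega> (tuple_mult \<Psi> A) \<Phi> = cadjoint A ** gram \<Omega> \<Psi> \<Phi>"
  using gram_tuple_mult[OF assms, of A "mat 1"] by (simp add: tuple_mult_mat_1)

lemma gram_tuple_mult_right:
  assumes "bounded \<Omega>" "\<Omega> \<in> sets lebesgue" "\<And>i. L2_loc (\<Psi> $ i)" "\<And>i. L2_loc (\<Phi> $ i)"
  shows "gram \<Omega> \<Psi> (tuple_mult \<Phi> B) = gram \<Omega> \<Psi> \<Phi> ** B"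
  using gram_tuple_mult[OF assms, of "mat 1" B] by (simp add: tuple_mult_mat_1 cadjoint_mat_1)

text \<open>\<open>V_nl\<close> acts on a tuple from the left and therefore commutes with
  multiplication by \<open>A\<close> from the right.\<close>

lemma gram_V_nl_tuple_mult:
  assumes \<Omega>: "bounded \<Omega>" "\<Omega> \<in> sets lebesgue"
    and \<Psi>: "\<And>i. L2_loc (\<Psi> $ i)" and M: "\<And>i. L2_loc (M $ i)"
  shows "gram \<Omega> (tuple_mult \<Psi> A) (V_nl \<Omega> M D (tuple_mult \<Psi> A))
    = cadjoint A ** gram \<Omega> \<Psi> (V_nl \<Omega> M D \<Psi>) ** A"
proof -
  have "V_nl \<Omega> M D (tuple_mult \<Psi> A) = tuple_mult (V_nl \<Omega> M D \<Psi>) A"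
    by (simp add: V_nl_def gram_tuple_mult_right[OF \<Omega> M \<Psi>] matrix_mul_assoc tuple_mult_assoc)
  moreover have "L2_loc (V_nl \<Omega> M D \<Psi> $ i)" for i
    unfolding V_nl_def by (rule tuple_mult_L2_loc[OF M])
  ultimately show ?thesis
    by (simp add: gram_tuple_mult[OF \<Omega> \<Psi>])
qed

lemma star_prod_tuple_mult:
  "star_prod (tuple_mult \<Psi> A) (tuple_mult \<Phi> B) r = cadjoint A ** star_prod \<Psi> \<Phi> r ** B"
proof -
  have "cnj (\<Sum>p\<in>UNIV. A $ p $ i * (\<Psi> $ p) r) * (\<Sum>q\<in>UNIV. B $ q $ j * (\<Phi> $ q) r)
      = (\<Sum>q\<in>UNIV. (\<Sum>p\<in>UNIV. cnj (A $ p $ i) * (cnj ((\<Psi> $ p) r) * (\<Phi> $ q) r)) * B $ q $ j)" for i j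
  proof -
    have "cnj (\<Sum>p\<in>UNIV. A $ p $ i * (\<Psi> $ p) r) * (\<Sum>q\<in>UNIV. B $ q $ j * (\<Phi> $ q) r)
      = (\<Sum>p\<in>UNIV. \<Sum>q\<in>UNIV. cnj (A $ p $ i) * (cnj ((\<Psi> $ p) r) * (\<Phi> $ q) r) * B $ q $ j)"
      unfolding cnj_sum sum_product by (simp add: mult_ac)
    also have "\<dots> = (\<Sum>q\<in>UNIV. \<Sum>p\<in>UNIV. cnj (A $ p $ i) * (cnj ((\<Psi> $ p) r) * (\<Phi> $ q) r) * B $ q $ j)"
      by (rule sum.swap)
    finally show ?thesis by (simp only: sum_distrib_right)
  qed
  then show ?thesis
    by (simp add: star_prod_def tuple_mult_def cadjoint_def matrix_matrix_mult_def vec_eq_iff)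
qed

section \<open>Functional calculus and the Fermi level\<close>

lemma matrix_mult_scaleR_left: "(a *\<^sub>R A) ** B = a *\<^sub>R (A ** B :: complex^'n^'m)"
  by (simp add: matrix_matrix_mult_def vec_eq_iff scaleR_sum_right)

lemma matrix_mult_scaleR_right: "A ** (a *\<^sub>R B) = a *\<^sub>R (A ** B :: complex^'n^'m)"
  by (simp add: matrix_matrix_mult_def vec_eq_iff scaleR_sum_right)

lemma matrix_add_rdistrib: "(A + B) ** C = A ** C + B ** (C :: complex^'n^'m)"
  by (simp add: matrix_matrix_mult_def vec_eq_iff sum.distrib distrib_right)

text \<open>If \<open>U\<close> diagonalizes \<open>A\<close>, then \<open>cadjoint P ** U\<close>
  diagonalizes the conjugate with the same eigenvalues; \<open>matrix_fun_eq\<close> permits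
  computing with this particular diagonalization.\<close>

lemma matrix_fun_conj:
  assumes A: "hermitian A" and P: "unitary P"
  shows "matrix_fun g (cadjoint P ** A ** P) = cadjoint P ** matrix_fun g A ** P"
proof -
  obtain U d where U: "unitary U" and d: "A = U ** diag_real d ** cadjoint U"
    using hermitian_diagonalization[OF A] by blast
  have "unitary (cadjoint P ** U)"
    using U P by (intro unitary_mult unitary_cadjoint)
  moreover have "cadjoint P ** A ** P = (cadjoint P ** U) ** diag_real d ** cadjoint (cadjoint P ** U)"
    by (simp add: d cadjoint_mult matrix_mul_assoc)
  ultimately have "matrix_fun g (cadjoint P ** A ** P)
      = (cadjoint P ** U) ** diag_real (\<lambda>i. g (d i)) ** cadjoint (cadjoint P ** U)"
    by (rule matrix_fun_eq)
  then show ?thesis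
    by (simp add: matrix_fun_eq[OF U d] cadjoint_mult matrix_mul_assoc)
qed

text \<open>The argument of the function contains only the difference of matrix and level, and
  conjugation by a unitary fixes multiples of the identity. So a shift of the matrix by c is a shift
  of the level by - c.\<close>

lemma smeared_shift_conj:
  assumes H: "hermitian H" and P: "unitary P"
  shows "smeared g \<sigma> \<mu> (cadjoint P ** (H + c *\<^sub>R mat 1) ** P) = cadjoint P ** smeared g \<sigma> (\<mu> - c) H ** P"
proof -
  have "hermitian ((1 / \<sigma>) *\<^sub>R (H - (\<mu> - c) *\<^sub>R mat 1))"
    using H by (simp add: hermitian_def cadjoint_scaleR cadjoint_diff cadjoint_mat_1)
  moreover have "cadjoint P ** ((1 / \<sigma>) *\<^sub>R (H - (\<mu> - c) *\<^sub>R mat 1)) ** P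
      = (1 / \<sigma>) *\<^sub>R (cadjoint P ** (H + c *\<^sub>R mat 1) ** P - \<mu> *\<^sub>R mat 1)"
  proof -
    have "H + c *\<^sub>R mat 1 = (H - (\<mu> - c) *\<^sub>R mat 1) + \<mu> *\<^sub>R mat 1"
      by (simp add: scaleR_diff_left)
    then have "cadjoint P ** (H + c *\<^sub>R mat 1) ** P = cadjoint P ** (H - (\<mu> - c) *\<^sub>R mat 1) ** P + \<mu> *\<^sub>R mat 1"
      using P by (simp only: matrix_add_ldistrib matrix_add_rdistrib matrix_mult_scaleR_left
          matrix_mult_scaleR_right unitary_def matrix_mul_rid)
    then show ?thesis
      by (simp add: matrix_mult_scaleR_left matrix_mult_scaleR_right)
  qed
  ultimately show ?thesis
    unfolding smeared_def using matrix_fun_conj[OF _ P] by metis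
qed

lemma trace_conj:
  assumes "unitary P"
  shows "trace (cadjoint P ** X ** P) = trace X"
proof -
  have "trace (cadjoint P ** X ** P) = trace (P ** cadjoint P ** X)"
    using trace_mul_sym[of "cadjoint P ** X" P] by (simp add: matrix_mul_assoc)
  then show ?thesis using assms by (simp add: unitary_def)
qed

lemma trace_conj_mult:
  assumes "unitary P"
  shows "trace ((cadjoint P ** X ** P) ** (cadjoint P ** F ** P)) = trace (X ** F)"
proof -
  have "(cadjoint P ** X ** P) ** (cadjoint P ** F ** P) = cadjoint P ** (X ** (P ** cadjoint P) ** F) ** P"
    by (simp only: matrix_mul_assoc)
  then show ?thesis using assms trace_conj by (simp add: unitary_def)
qed

text \<open>The eigenvalues \<open>d\<close> are obtained before g, \<sigma> and \<mu> are fixed,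
  which makes the trace an explicit function of \<mu>.\<close>

lemma trace_smeared:
  fixes H :: "complex^'n^'n"
  assumes "hermitian H"
  obtains d :: "'n \<Rightarrow> real" where "\<And>g \<sigma> \<mu>. trace (smeared g \<sigma> \<mu> H) = complex_of_real (\<Sum>i\<in>UNIV. g ((d i - \<mu>) / \<sigma>))"
proof -
  obtain U d where U: "unitary U" and d: "H = U ** diag_real d ** cadjoint U"
    using hermitian_diagonalization[OF assms] by blast
  have "trace (smeared g \<sigma> \<mu> H) = complex_of_real (\<Sum>i\<in>UNIV. g ((d i - \<mu>) / \<sigma>))" for g \<sigma> \<mu>
  proof -
    have "cadjoint U ** H ** U = (cadjoint U ** U) ** diag_real d ** (cadjoint U ** U)"
      by (simp add: d matrix_mul_assoc)
    \<comment> \<open>The zero shift makes this an instance of \<open>smeared_shift_conj\<close>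
      with c = 0.\<close>
    then have D: "cadjoint U ** (H + 0 *\<^sub>R mat 1) ** U = diag_real d"
      using U by (simp add: unitary_def)
    have "(1 / \<sigma>) *\<^sub>R (diag_real d - \<mu> *\<^sub>R mat 1) = (diag_real (\<lambda>i. (d i - \<mu>) / \<sigma>) :: complex^'n^'n)"
      by (simp add: diag_real_def mat_def vec_eq_iff) (simp add: scaleR_conv_of_real)
    then have "smeared g \<sigma> \<mu> (diag_real d :: complex^'n^'n) = diag_real (\<lambda>i. g ((d i - \<mu>) / \<sigma>))"
      unfolding smeared_def
      using matrix_fun_eq[of "mat 1 :: complex^'n^'n" "diag_real (\<lambda>i. (d i - \<mu>) / \<sigma>)" "\<lambda>i. (d i - \<mu>) / \<sigma>" g]
      by (simp add: unitary_def cadjoint_mat_1)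
    then have "trace (cadjoint U ** smeared g \<sigma> \<mu> H ** U) = trace (diag_real (\<lambda>i. g ((d i - \<mu>) / \<sigma>)) :: complex^'n^'n)"
      using smeared_shift_conj[OF assms U, of g \<sigma> \<mu> 0] D by simp
    then show ?thesis
      by (simp add: trace_conj[OF U]) (simp add: trace_def diag_real_def)
  qed
  then show thesis by (rule that)
qed

section \<open>Existence, uniqueness and shift of the Fermi level\<close>

lemma real_analytic_isCont:
  assumes "real_analytic g"
  shows "isCont g x"
proof -
  obtain a e where e: "e > 0" and s: "\<And>y. \<bar>y - x\<bar> < e \<Longrightarrow> (\<lambda>n. a n * (y - x) ^ n) sums g y"
    using assms unfolding real_analytic_def by blast
  have s': "(\<lambda>n. a n * h ^ n) sums g (x + h)" if "\<bar>h\<bar> < e" for h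
    using s[of "x + h"] that by simp
  have "isCont (\<lambda>h. \<Sum>n. a n * h ^ n) 0"
    by (rule isCont_powser[of _ "e / 2"]) (use s'[of "e / 2"] e in \<open>auto simp: sums_iff\<close>)
  then have "((\<lambda>h. \<Sum>n. a n * h ^ n) \<longlongrightarrow> g x) (at 0)"
    using s'[of 0] e by (simp add: isCont_def sums_iff)
  moreover have "\<forall>\<^sub>F h in at 0. (\<Sum>n. a n * h ^ n) = g (x + h)"
    unfolding eventually_at using s' e by (auto simp: sums_iff intro!: exI[of _ e])
  ultimately have "((\<lambda>h. g (x + h)) \<longlongrightarrow> g x) (at 0)"
    by (rule Lim_transform_eventually)
  then show ?thesis by (simp add: isCont_iff)
qed

text \<open>By \<open>trace_smeared\<close> the electron number is a real function \<open>N\<close>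
  of \<mu>, continuous and strictly increasing because \<open>f\<close> decreases and \<mu> enters
  its argument with a minus sign. It tends to 0 and to twice the matrix size, the weights summing to
  2, so \<open>Ne\<close> lies strictly between its limits.\<close>

lemma fermi_level_unique:
  fixes \<eta> :: "real^3 \<Rightarrow> complex^'n^'n"
  assumes K: "finite K" and w: "\<And>k. k \<in> K \<Longrightarrow> w k > 0" "(\<Sum>k\<in>K. w k) = 2" and \<sigma>: "\<sigma> > 0"
    and Ne: "0 < Ne" "Ne < 2 * CARD('n)" and f: "smearing f S"
    and \<eta>: "\<And>k. k \<in> K \<Longrightarrow> hermitian (\<eta> k)"
  shows "\<exists>!\<mu>. (\<Sum>k\<in>K. complex_of_real (w k) * trace (smeared f \<sigma> \<mu> (\<eta> k))) = of_nat Ne"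
proof -
  have "\<exists>d. \<forall>k\<in>K. \<forall>\<mu>. trace (smeared f \<sigma> \<mu> (\<eta> k)) = complex_of_real (\<Sum>i\<in>(UNIV::'n set). f ((d k i - \<mu>) / \<sigma>))"
  proof (intro bchoice ballI)
    fix k
    assume "k \<in> K"
    obtain e :: "'n \<Rightarrow> real" where "\<And>g \<sigma> \<mu>. trace (smeared g \<sigma> \<mu> (\<eta> k)) = complex_of_real (\<Sum>i\<in>UNIV. g ((e i - \<mu>) / \<sigma>))"
      using trace_smeared[OF \<eta>[OF \<open>k \<in> K\<close>]] by blast
    then show "\<exists>e. \<forall>\<mu>. trace (smeared f \<sigma> \<mu> (\<eta> k)) = complex_of_real (\<Sum>i\<in>(UNIV::'n set). f ((e i - \<mu>) / \<sigma>))"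
      by (intro exI[of _ e]) simp
  qed
  then obtain d :: "real^3 \<Rightarrow> 'n \<Rightarrow> real" where d: "\<And>k \<mu>. k \<in> K \<Longrightarrow>
      trace (smeared f \<sigma> \<mu> (\<eta> k)) = complex_of_real (\<Sum>i\<in>UNIV. f ((d k i - \<mu>) / \<sigma>))"
    by blast
  define N where "N \<mu> = (\<Sum>k\<in>K. w k * (\<Sum>i\<in>(UNIV::'n set). f ((d k i - \<mu>) / \<sigma>)))" for \<mu>
  have "(\<Sum>k\<in>K. complex_of_real (w k) * trace (smeared f \<sigma> \<mu> (\<eta> k))) = complex_of_real (N \<mu>)" for \<mu>
    by (simp add: N_def d)
  then have eq: "(\<Sum>k\<in>K. complex_of_real (w k) * trace (smeared f \<sigma> \<mu> (\<eta> k))) = of_nat Ne \<longleftrightarrow> N \<mu> = real Ne" for \<mu>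
    by (metis of_real_eq_iff of_real_of_nat_eq)
  \<comment> \<open>A sum over the empty set would not be strictly monotone.\<close>
  have Kne: "K \<noteq> {}" using w(2) by auto
  have mono: "N \<mu> < N \<nu>" if "\<mu> < \<nu>" for \<mu> \<nu>
    unfolding N_def
  proof (intro sum_strict_mono K Kne mult_strict_left_mono w(1))
    fix k :: "real^3" and i :: 'n
    have "(d k i - \<nu>) / \<sigma> < (d k i - \<mu>) / \<sigma>"
      using that \<sigma> by (simp add: divide_strict_right_mono)
    then show "f ((d k i - \<mu>) / \<sigma>) < f ((d k i - \<nu>) / \<sigma>)"
      using f by (auto simp: smearing_def monotone_on_def)
  qed auto
  have cont: "isCont N \<mu>" for \<mu>
  proof -
    have f': "isCont f x" for x
      using f by (simp add: smearing_def real_analytic_isCont)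
    have "isCont (\<lambda>\<mu>. f ((a - \<mu>) / \<sigma>)) \<mu>" for a
      by (rule isCont_o2[where g = f, OF _ f']) (use \<sigma> in simp)
    then show ?thesis
      unfolding N_def by (intro continuous_sum continuous_mult continuous_const)
  qed
  have lin: "filterlim (\<lambda>\<mu>. (a - \<mu>) / \<sigma>) at_bot at_top" "filterlim (\<lambda>\<mu>. (a - \<mu>) / \<sigma>) at_top at_bot" for a
  proof -
    show "filterlim (\<lambda>\<mu>. (a - \<mu>) / \<sigma>) at_bot at_top"
      unfolding filterlim_at_bot eventually_at_top_linorder
    proof (intro allI exI impI)
      show "(a - \<mu>) / \<sigma> \<le> Z" if "a - \<sigma> * Z \<le> \<mu>" for Z \<mu>
        using that \<sigma> by (simp add: field_simps)
    qed
    show "filterlim (\<lambda>\<mu>. (a - \<mu>) / \<sigma>) at_top at_bot"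
      unfolding filterlim_at_top eventually_at_bot_linorder
    proof (intro allI exI impI)
      show "Z \<le> (a - \<mu>) / \<sigma>" if "\<mu> \<le> a - \<sigma> * Z" for Z \<mu>
        using that \<sigma> by (simp add: field_simps)
    qed
  qed
  have "(N \<longlongrightarrow> (\<Sum>k\<in>K. w k * (\<Sum>i\<in>(UNIV::'n set). 1))) at_top"
    unfolding N_def using f
    by (intro tendsto_sum tendsto_mult tendsto_const filterlim_compose[of f, OF _ lin(1)])
      (auto simp: smearing_def)
  moreover have "(\<Sum>k\<in>K. w k * (\<Sum>i\<in>(UNIV::'n set). 1)) = 2 * real CARD('n)"
    using w(2) by (simp flip: sum_distrib_right)
  ultimately have "\<forall>\<^sub>F \<mu> in at_top. N \<mu> > real Ne"
    using Ne(2) by (intro order_tendstoD(1)) (auto simp flip: of_nat_mult)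
  then obtain \<nu> where \<nu>: "N \<nu> > real Ne"
    using eventually_happens trivial_limit_at_top_linorder by blast
  have "(N \<longlongrightarrow> (\<Sum>k\<in>K. w k * (\<Sum>i\<in>(UNIV::'n set). 0))) at_bot"
    unfolding N_def using f
    by (intro tendsto_sum tendsto_mult tendsto_const filterlim_compose[of f, OF _ lin(2)])
      (auto simp: smearing_def)
  then have "\<forall>\<^sub>F \<mu> in at_bot. N \<mu> < real Ne"
    using Ne(1) by (intro order_tendstoD(2)) auto
  then obtain \<mu> where \<mu>: "N \<mu> < real Ne"
    using eventually_happens trivial_limit_at_bot_linorder by blast
  have "\<mu> \<le> \<nu>"
    using mono[of \<nu> \<mu>] \<mu> \<nu> by linarith
  then obtain x where "N x = real Ne"
    using IVT[of N \<mu> "real Ne" \<nu>] \<mu> \<nu> cont by auto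
  moreover have "x = y" if "N x = N y" for x y
    using mono[of x y] mono[of y x] that by linarith
  ultimately show ?thesis unfolding eq by metis
qed

text \<open>Traces ignore the conjugation, so the new equation at \<mu> is the old one at \<mu> - c.
  Unique solvability is what lets \<open>THE\<close> follow this translation.\<close>

lemma fermi_level_shift_conj:
  fixes \<eta> :: "real^3 \<Rightarrow> complex^'n^'n"
  assumes K: "finite K" and w: "\<And>k. k \<in> K \<Longrightarrow> w k > 0" "(\<Sum>k\<in>K. w k) = 2" and \<sigma>: "\<sigma> > 0"
    and Ne: "0 < Ne" "Ne < 2 * CARD('n)" and f: "smearing f S"
    and \<eta>: "\<And>k. k \<in> K \<Longrightarrow> hermitian (\<eta> k)" and P: "\<And>k. k \<in> K \<Longrightarrow> unitary (P k)"
  shows "fermi_level K w \<sigma> Ne f (\<lambda>k. cadjoint (P k) ** (\<eta> k + c *\<^sub>R mat 1) ** P k)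
    = fermi_level K w \<sigma> Ne f \<eta> + c"
proof -
  let ?E = "\<lambda>\<mu>. (\<Sum>k\<in>K. complex_of_real (w k) * trace (smeared f \<sigma> \<mu> (\<eta> k))) = of_nat Ne"
  have ex1: "\<exists>!\<mu>. ?E \<mu>"
    by (rule fermi_level_unique[OF K w \<sigma> Ne f \<eta>])
  have "(\<Sum>k\<in>K. complex_of_real (w k) * trace (smeared f \<sigma> \<mu> (cadjoint (P k) ** (\<eta> k + c *\<^sub>R mat 1) ** P k)))
      = (\<Sum>k\<in>K. complex_of_real (w k) * trace (smeared f \<sigma> (\<mu> - c) (\<eta> k)))" for \<mu>
    by (intro sum.cong refl) (simp add: smeared_shift_conj \<eta> P trace_conj)
  then have "fermi_level K w \<sigma> Ne f (\<lambda>k. cadjoint (P k) ** (\<eta> k + c *\<^sub>R mat 1) ** P k) = (THE \<mu>. ?E (\<mu> - c))"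
    by (simp add: fermi_level_def)
  also have "\<dots> = (THE \<mu>. ?E \<mu>) + c"
  proof (rule the_equality)
    show "?E ((THE \<mu>. ?E \<mu>) + c - c)"
      using theI'[OF ex1] by simp
    show "\<mu> = (THE \<mu>. ?E \<mu>) + c" if "?E (\<mu> - c)" for \<mu>
      using the1_equality[OF ex1 that] by simp
  qed
  finally show ?thesis by (simp add: fermi_level_def)
qed

section \<open>Invariance of the energy\<close>

theorem theorem3p1:
  fixes R \<Omega> K :: "(real^3) set"
    and w :: "real^3 \<Rightarrow> real" and \<sigma> :: real and Ne :: nat
    and f S :: "real \<Rightarrow> real"
    and M :: "(real^3 \<Rightarrow> complex)^'m"
    and Q :: "real^3 \<Rightarrow> complex^'m^'m"
    and D :: "complex^'m^'m"
    and Vloc :: "real^3 \<Rightarrow> complex"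
    and Exc :: "(real^3 \<Rightarrow> complex) \<Rightarrow> complex"
    and \<Psi> :: "real^3 \<Rightarrow> (real^3 \<Rightarrow> complex)^'n"
    and \<eta> P :: "real^3 \<Rightarrow> complex^'n^'n"
    and c :: real
  assumes "bravais_lattice R" and "unit_cell R \<Omega>"
    and "finite K" and "\<forall>k\<in>K. w k > 0" and "(\<Sum>k\<in>K. w k) = 2"
    and "\<sigma> > 0" and "0 < Ne" and "Ne < 2 * CARD('n)"
    and "smearing f S"
    and "\<forall>i. M $ i \<in> L2_per R"
    and "\<forall>x. hermitian (Q x)" and "\<forall>i j. (\<lambda>x. Q x $ i $ j) \<in> L2_per R"
    and "hermitian D"
    and "Vloc \<in> L2_per R"
    and "\<forall>k\<in>K. \<forall>i. \<Psi> k $ i \<in> H1_per R"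
    and "\<forall>k\<in>K. hermitian (\<eta> k)"
    and "\<forall>k\<in>K. unitary (P k)"
  shows "energy \<Omega> K w \<sigma> Ne f S M Q D Vloc Exc
           (\<lambda>k. tuple_mult (\<Psi> k) (P k))
           (\<lambda>k. cadjoint (P k) ** (\<eta> k + c *\<^sub>R mat 1) ** P k)
         = energy \<Omega> K w \<sigma> Ne f S M Q D Vloc Exc \<Psi> \<eta>"
proof -
  have \<Omega>: "bounded \<Omega>" "\<Omega> \<in> sets lebesgue"
    using assms(2) by (simp_all add: unit_cell_def)
  have M: "\<And>i. L2_loc (M $ i)"
    using assms(10) by (simp add: L2_per_def)
  have H1: "\<Psi> k $ i \<in> H1_per R" and L: "L2_loc (\<Psi> k $ i)" and \<eta>: "hermitian (\<eta> k)" and P: "unitary (P k)"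
    if "k \<in> K" for k i
    using that assms(15-17) by (auto intro: H1_per_L2_loc)
  let ?\<Psi> = "\<lambda>k. tuple_mult (\<Psi> k) (P k)" and ?\<eta> = "\<lambda>k. cadjoint (P k) ** (\<eta> k + c *\<^sub>R mat 1) ** P k"
  define \<mu> where "\<mu> = fermi_level K w \<sigma> Ne f \<eta>"
  have \<mu>: "fermi_level K w \<sigma> Ne f ?\<eta> = \<mu> + c"
    unfolding \<mu>_def by (rule fermi_level_shift_conj) (use assms \<eta> P in auto)
  \<comment> \<open>Kept general in \<open>g\<close>, since the occupations use it for
    \<open>f\<close> and the entropy for \<open>S\<close>.\<close>
  have smear: "smeared g \<sigma> (\<mu> + c) (?\<eta> k) = cadjoint (P k) ** smeared g \<sigma> \<mu> (\<eta> k) ** P k" if "k \<in> K" for g k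
    using smeared_shift_conj[OF \<eta>[OF that] P[OF that], of g \<sigma> "\<mu> + c" c] by simp
  \<comment> \<open>Equality as functions, so the local, Hartree and exchange-correlation terms
    agree by substitution.\<close>
  have dens: "density \<Omega> K w \<sigma> Ne f M Q ?\<Psi> ?\<eta> = density \<Omega> K w \<sigma> Ne f M Q \<Psi> \<eta>"
  proof
    fix r
    have "trace ((star_prod (?\<Psi> k) (?\<Psi> k) r + gram \<Omega> (?\<Psi> k) M ** Q r ** gram \<Omega> M (?\<Psi> k))
          ** smeared f \<sigma> (\<mu> + c) (?\<eta> k))
        = trace ((star_prod (\<Psi> k) (\<Psi> k) r + gram \<Omega> (\<Psi> k) M ** Q r ** gram \<Omega> M (\<Psi> k))
          ** smeared f \<sigma> \<mu> (\<eta> k))" if "k \<in> K" for k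
    proof -
      have "star_prod (?\<Psi> k) (?\<Psi> k) r + gram \<Omega> (?\<Psi> k) M ** Q r ** gram \<Omega> M (?\<Psi> k)
          = cadjoint (P k) ** (star_prod (\<Psi> k) (\<Psi> k) r + gram \<Omega> (\<Psi> k) M ** Q r ** gram \<Omega> M (\<Psi> k)) ** P k"
        by (simp add: star_prod_tuple_mult gram_tuple_mult_left[OF \<Omega> L[OF that] M]
            gram_tuple_mult_right[OF \<Omega> M L[OF that]] matrix_add_ldistrib matrix_add_rdistrib matrix_mul_assoc)
      then show ?thesis
        by (simp only: smear[OF that] trace_conj_mult[OF P[OF that]])
    qed
    then show "density \<Omega> K w \<sigma> Ne f M Q ?\<Psi> ?\<eta> r = density \<Omega> K w \<sigma> Ne f M Q \<Psi> \<eta> r"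
      unfolding density_def \<mu> \<mu>_def[symmetric] by (intro sum.cong refl) simp
  qed
  have kin: "trace ((kinetic_matrix \<Omega> k (?\<Psi> k) + gram \<Omega> (?\<Psi> k) (V_nl \<Omega> M D (?\<Psi> k))) ** smeared f \<sigma> (\<mu> + c) (?\<eta> k))
      = trace ((kinetic_matrix \<Omega> k (\<Psi> k) + gram \<Omega> (\<Psi> k) (V_nl \<Omega> M D (\<Psi> k))) ** smeared f \<sigma> \<mu> (\<eta> k))"
    if "k \<in> K" for k
  proof -
    have "kinetic_matrix \<Omega> k (?\<Psi> k) + gram \<Omega> (?\<Psi> k) (V_nl \<Omega> M D (?\<Psi> k))
        = cadjoint (P k) ** (kinetic_matrix \<Omega> k (\<Psi> k) + gram \<Omega> (\<Psi> k) (V_nl \<Omega> M D (\<Psi> k))) ** P k"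
      by (simp add: kinetic_matrix_tuple_mult[OF \<Omega> H1[OF that]] gram_V_nl_tuple_mult[OF \<Omega> L[OF that] M]
          matrix_add_ldistrib matrix_add_rdistrib)
    then show ?thesis
      by (simp only: smear[OF that] trace_conj_mult[OF P[OF that]])
  qed
  have ent: "trace (smeared S \<sigma> (\<mu> + c) (?\<eta> k)) = trace (smeared S \<sigma> \<mu> (\<eta> k))" if "k \<in> K" for k
    using smear[OF that] trace_conj[OF P[OF that]] by simp
  show ?thesis
    unfolding energy_def Let_def dens \<mu> \<mu>_def[symmetric]
    by (simp add: kin ent cong: sum.cong)
qed

end
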